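(* Let $\Gamma$ be a finitely generated, (Gromov) hyperbolic, right-angled Coxeter group with finite generating set $S$ and with chromatic number $n$. Then there exists a quasiisometric embedding $\psi: C(\Gamma,S)\to T\times\cdots\times T$ ($n$ factors) of the Cayley graph of $\Gamma$ with respect to $S$ into the $n$-fold product of the binary tree $T$.
   Context: A finitely generated right-angled Coxeter group is a group $\Gamma$ together with a finite generating set $S$ such that every element of $S$ has order two and all relations are consequences of these and of relations of the form $st=ts$ for certain pairs $s,t\in S$. The nerve $N(\Gamma,S)$ is the simplicial complex with vertex set $S$ in which distinct vertices $s_1,\dots,s_{k+1}$ span a simplex iff they commute pairwise. The chromatic number of $\Gamma$ is the chromatic number of the 1-skeleton of $N(\Gamma,S)$, i.e. the minimal number of colors needed to color $S$ so that distinct commuting generators get different colors. $C(\Gamma,S)$ is the Cayley graph with its simplicial metric (all edges of length 1). The binary tree $T=T_{\{0,1\}}$ is the rooted tree whose vertices are the finite sequences (including the empty one, the root) with entries in $\{0,1\}$, two vertices being joined by an edge iff one is obtained from the other by erasing the last term; all edges have length 1. Products of trees carry the $l_1$-product metric (distance is the sum of the distances in the factors). *)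

theory Defs
  imports Complex_Main "HOL-Library.FuncSet" "HOL-Algebra.Multiplicative_Group" "HOL-Algebra.Generated_Groups"
begin

section \<open>Right-angled Coxeter groups\<close>

text \<open>
  A group word over \<open>S\<close> is a list of signed generators: \<open>(s, True)\<close> stands for \<open>s\<close> and
  \<open>(s, False)\<close> for the formal inverse of \<open>s\<close>.
\<close>

definition letter_value :: "('a, 'b) monoid_scheme \<Rightarrow> 'a \<times> bool \<Rightarrow> 'a" where
  "letter_value G x = (if snd x then fst x else inv\<^bsub>G\<^esub> (fst x))"

definition word_value :: "('a, 'b) monoid_scheme \<Rightarrow> ('a \<times> bool) list \<Rightarrow> 'a" where
  "word_value G w = foldr (\<lambda>x g. letter_value G x \<otimes>\<^bsub>G\<^esub> g) w \<one>\<^bsub>G\<^esub>"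

text \<open>
  Two words are equivalent iff they represent the same element of the abstractly presented group
  with generators \<open>S\<close> and relations \<open>ss = 1\<close> for \<open>s \<in> S\<close> and \<open>st = ts\<close> for \<open>(s, t) \<in> C\<close>.
\<close>

inductive racg_equiv ::
    "'a set \<Rightarrow> ('a \<times> 'a) set \<Rightarrow> ('a \<times> bool) list \<Rightarrow> ('a \<times> bool) list \<Rightarrow> bool"
  for S :: "'a set" and C :: "('a \<times> 'a) set" where
  cancel: "s \<in> S \<Longrightarrow> racg_equiv S C [(s, b), (s, \<not> b)] []"
| involution: "s \<in> S \<Longrightarrow> racg_equiv S C [(s, True), (s, True)] []"
| commute: "(s, t) \<in> C \<Longrightarrow>
    racg_equiv S C [(s, True), (t, True)] [(t, True), (s, True)]"
| refl: "racg_equiv S C w w"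
| sym: "racg_equiv S C v w \<Longrightarrow> racg_equiv S C w v"
| trans: "racg_equiv S C u v \<Longrightarrow> racg_equiv S C v w \<Longrightarrow> racg_equiv S C u w"
| congruence: "racg_equiv S C v w \<Longrightarrow> racg_equiv S C (x @ v @ y) (x @ w @ y)"

definition right_angled_coxeter_group :: "('a, 'b) monoid_scheme \<Rightarrow> 'a set \<Rightarrow> bool" where
  "right_angled_coxeter_group G S \<longleftrightarrow>
     group G \<and> finite S \<and> S \<subseteq> carrier G \<and> generate G S = carrier G \<and>
     (\<forall>s\<in>S. group.ord G s = 2) \<and>
     (\<exists>C \<subseteq> S \<times> S.
        (\<forall>(s, t) \<in> C. s \<otimes>\<^bsub>G\<^esub> t = t \<otimes>\<^bsub>G\<^esub> s) \<and>
        (\<forall>w \<in> lists (S \<times> UNIV). word_value G w = \<one>\<^bsub>G\<^esub> \<longrightarrow> racg_equiv S C w []))"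

section \<open>Nerve and chromatic number\<close>

text \<open>Simplicial complexes are represented by the set of their nonempty simplices.\<close>

definition nerve :: "('a, 'b) monoid_scheme \<Rightarrow> 'a set \<Rightarrow> 'a set set" where
  "nerve G S = {\<sigma>. finite \<sigma> \<and> \<sigma> \<noteq> {} \<and> \<sigma> \<subseteq> S \<and>
                   (\<forall>s\<in>\<sigma>. \<forall>t\<in>\<sigma>. s \<otimes>\<^bsub>G\<^esub> t = t \<otimes>\<^bsub>G\<^esub> s)}"

definition edges_of_complex :: "'v set set \<Rightarrow> 'v set set" where
  "edges_of_complex K = {\<sigma> \<in> K. card \<sigma> = 2}"

text \<open>A graph is given by its vertex set \<open>V\<close> and its set \<open>E\<close> of two-element edges.\<close>

definition proper_colouring :: "'v set \<Rightarrow> 'v set set \<Rightarrow> nat \<Rightarrow> ('v \<Rightarrow> nat) \<Rightarrow> bool" where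
  "proper_colouring V E k c \<longleftrightarrow>
     c ` V \<subseteq> {..<k} \<and> (\<forall>u\<in>V. \<forall>v\<in>V. u \<noteq> v \<and> {u, v} \<in> E \<longrightarrow> c u \<noteq> c v)"

definition chromatic_number :: "'v set \<Rightarrow> 'v set set \<Rightarrow> nat" where
  "chromatic_number V E = (LEAST k. \<exists>c. proper_colouring V E k c)"

definition racg_chromatic_number :: "('a, 'b) monoid_scheme \<Rightarrow> 'a set \<Rightarrow> nat" where
  "racg_chromatic_number G S = chromatic_number S (edges_of_complex (nerve G S))"

section \<open>Graphs as metric spaces\<close>

text \<open>
  Points of the geometric realization of a graph are given by their barycentric coordinates, so
  the vertex \<open>v\<close> is the indicator function of \<open>v\<close>.
\<close>

definition graph_cells :: "'v set \<Rightarrow> 'v set set \<Rightarrow> 'v set set" where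
  "graph_cells V E = (\<lambda>v. {v}) ` V \<union> E"

definition cell_points :: "'v set \<Rightarrow> ('v \<Rightarrow> real) set" where
  "cell_points \<sigma> = {p. (\<forall>v. 0 \<le> p v) \<and> (\<forall>v. v \<notin> \<sigma> \<longrightarrow> p v = 0) \<and> (\<Sum>v\<in>\<sigma>. p v) = 1}"

definition graph_points :: "'v set \<Rightarrow> 'v set set \<Rightarrow> ('v \<Rightarrow> real) set" where
  "graph_points V E = (\<Union>\<sigma> \<in> graph_cells V E. cell_points \<sigma>)"

text \<open>
  \<open>graph_path V E p q l\<close>: there is a path of length \<open>l\<close> from \<open>p\<close> to \<open>q\<close> composed of finitely many
  segments, each inside one cell. On an edge \<open>{u, v}\<close> both coordinates change by the same
  amount, whence the factor 1/2 that makes every edge have length 1.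
\<close>

inductive graph_path ::
    "'v set \<Rightarrow> 'v set set \<Rightarrow> ('v \<Rightarrow> real) \<Rightarrow> ('v \<Rightarrow> real) \<Rightarrow> real \<Rightarrow> bool"
  for V :: "'v set" and E :: "'v set set" where
  start: "p \<in> graph_points V E \<Longrightarrow> graph_path V E p p 0"
| segment: "graph_path V E p q l \<Longrightarrow> \<sigma> \<in> graph_cells V E \<Longrightarrow>
    q \<in> cell_points \<sigma> \<Longrightarrow> r \<in> cell_points \<sigma> \<Longrightarrow>
    graph_path V E p r (l + (\<Sum>v\<in>\<sigma>. \<bar>q v - r v\<bar>) / 2)"

text \<open>Only meaningful for connected graphs, since the infimum of the empty set is unspecified.\<close>

definition graph_dist ::
    "'v set \<Rightarrow> 'v set set \<Rightarrow> ('v \<Rightarrow> real) \<Rightarrow> ('v \<Rightarrow> real) \<Rightarrow> real" where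
  "graph_dist V E p q = Inf {l. graph_path V E p q l}"

text \<open>
  The edge from \<open>g\<close> to \<open>gs\<close> and the one from \<open>gs\<close> to \<open>gss = g\<close> are identified, so for generators
  of order two this is a graph without loops and multiple edges.
\<close>

definition cayley_edges :: "('a, 'b) monoid_scheme \<Rightarrow> 'a set \<Rightarrow> 'a set set" where
  "cayley_edges G S = {{g, g \<otimes>\<^bsub>G\<^esub> s} | g s. g \<in> carrier G \<and> s \<in> S}"

definition cayley_graph :: "('a, 'b) monoid_scheme \<Rightarrow> 'a set \<Rightarrow> ('a \<Rightarrow> real) set" where
  "cayley_graph G S = graph_points (carrier G) (cayley_edges G S)"

definition cayley_dist ::
    "('a, 'b) monoid_scheme \<Rightarrow> 'a set \<Rightarrow> ('a \<Rightarrow> real) \<Rightarrow> ('a \<Rightarrow> real) \<Rightarrow> real" where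
  "cayley_dist G S = graph_dist (carrier G) (cayley_edges G S)"

text \<open>In the binary tree, \<open>False\<close> and \<open>True\<close> play the roles of 0 and 1.\<close>

definition binary_tree_edges :: "bool list set set" where
  "binary_tree_edges = {{w, butlast w} | w. w \<noteq> []}"

definition binary_tree :: "(bool list \<Rightarrow> real) set" where
  "binary_tree = graph_points UNIV binary_tree_edges"

definition binary_tree_dist :: "(bool list \<Rightarrow> real) \<Rightarrow> (bool list \<Rightarrow> real) \<Rightarrow> real" where
  "binary_tree_dist = graph_dist UNIV binary_tree_edges"

definition power_space :: "nat \<Rightarrow> 'x set \<Rightarrow> (nat \<Rightarrow> 'x) set" where
  "power_space n X = PiE {..<n} (\<lambda>_. X)"

definition l1_dist :: "nat \<Rightarrow> ('x \<Rightarrow> 'x \<Rightarrow> real) \<Rightarrow> (nat \<Rightarrow> 'x) \<Rightarrow> (nat \<Rightarrow> 'x) \<Rightarrow> real" where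
  "l1_dist n d x y = (\<Sum>i<n. d (x i) (y i))"

section \<open>Coarse geometry\<close>

definition gromov_product :: "('x \<Rightarrow> 'x \<Rightarrow> real) \<Rightarrow> 'x \<Rightarrow> 'x \<Rightarrow> 'x \<Rightarrow> real" where
  "gromov_product d w x y = (d x w + d y w - d x y) / 2"

definition gromov_hyperbolic :: "'x set \<Rightarrow> ('x \<Rightarrow> 'x \<Rightarrow> real) \<Rightarrow> bool" where
  "gromov_hyperbolic X d \<longleftrightarrow>
     (\<exists>\<delta>\<ge>0. \<forall>w\<in>X. \<forall>x\<in>X. \<forall>y\<in>X. \<forall>z\<in>X.
        gromov_product d w x z \<ge> min (gromov_product d w x y) (gromov_product d w y z) - \<delta>)"

definition quasiisometric_embedding ::
    "'x set \<Rightarrow> ('x \<Rightarrow> 'x \<Rightarrow> real) \<Rightarrow> 'y set \<Rightarrow> ('y \<Rightarrow> 'y \<Rightarrow> real) \<Rightarrow> ('x \<Rightarrow> 'y) \<Rightarrow> bool" where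
  "quasiisometric_embedding X dX Y dY f \<longleftrightarrow>
     f \<in> X \<rightarrow> Y \<and>
     (\<exists>L A. L \<ge> 1 \<and> A \<ge> 0 \<and>
        (\<forall>x\<in>X. \<forall>y\<in>X. dX x y / L - A \<le> dY (f x) (f y) \<and> dY (f x) (f y) \<le> L * dX x y + A))"

end

theory Submission
  imports Defs "HOL-Analysis.Function_Topology"
begin

text \<open>
  Fix an optimal colouring of the generators. A word crosses, with its letter \<open>s\<close> read at the group
  element \<open>x\<close>, the wall of the reflection \<open>x s x\<^sup>-\<^sup>1\<close>. For each colour, record the walls of that colour that
  are crossed, cancelling a wall that is crossed twice in succession. The relations \<open>ss = 1\<close> do not
  change this record, and neither do the relations \<open>st = ts\<close>, because \<open>s\<close> and \<open>t\<close> have different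
  colours. So each element has for each colour a list of walls, its address, which is a vertex of a
  rooted tree (of infinite valence in general). In a reduced word all walls are distinct, so a
  geodesic of the group never backtracks in any of these trees, and the addresses embed the group
  isometrically into the product of the trees (\<open>word_dist_eq_sum_tree_dist\<close>).

  The infinite alphabet of walls is then replaced by a finite one: every wall gets one of finitely
  many labels, and the address becomes a list of labels, hence, with labels written as bit strings of
  equal length, a vertex of the binary tree. Such maps do not increase distances much. For a lower bound,
  suppose that the labelled addresses of \<open>g\<close> and \<open>h\<close> are much closer than \<open>d(g, h)\<close>. In some colour
  the true addresses then branch, but continue with equal labels for \<open>N\<close> further walls, where \<open>N\<close> is at
  least a fixed fraction of \<open>d(g, h)\<close>. The labelling has to exclude all such coincidences.

  The labelling exists by Rosenfeld's counting argument, an elementary substitute for the local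
  lemma: it suffices that each wall takes part in at most \<open>B\<^sup>N\<close> coincidences of size \<open>N\<close>
  (\<open>exists_separating_labelling\<close>). Here hyperbolicity enters (\<open>midpoint_near\<close>). A reflection \<open>r\<close> is twice
  as long as the geodesic to its wall, and its midpoint \<open>b\<close> lies next to that wall. If \<open>r\<close> separates
  \<open>g\<close> from the identity, then \<open>r\<close> and \<open>g\<close> have Gromov product at least \<open>|r| / 2\<close>, so \<open>b\<close> is close to a
  geodesic from the identity to \<open>g\<close>. If moreover more than \<open>2 \<delta>\<close> walls of the same colour separate
  \<open>b\<close> and \<open>g\<close> from \<open>h\<close>, then \<open>b\<close> cannot lie before the branching point of the geodesics
  to \<open>g\<close> and \<open>h\<close>, and \<open>d(b, g)\<close> is at most \<open>d(g, h)\<close> up to a constant. Thus, after the first few walls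
  behind a branching are discarded, the pairs \<open>(g, h)\<close> responsible for the coincidences through \<open>r\<close>
  lie in a ball of radius \<open>O(N)\<close> around \<open>b\<close>, and there are exponentially many at most.
\<close>

section \<open>Words as vertices of a rooted tree\<close>

text \<open>
  Words over an alphabet are the vertices of a rooted tree, a word being joined to its one-letter
  extensions. The part of \<open>u\<close> beyond the longest common prefix with \<open>v\<close> is the part of the geodesic
  between the two that lies on the side of \<open>u\<close>.
\<close>

fun branch :: "'x list \<Rightarrow> 'x list \<Rightarrow> 'x list" where
  "branch (x # u) (y # v) = (if x = y then branch u v else x # u)"
| "branch u v = u"

definition tree_dist :: "'x list \<Rightarrow> 'x list \<Rightarrow> nat" where
  "tree_dist u v = length (branch u v) + length (branch v u)"

lemma branch_common_prefix: "\<exists>P. u = P @ branch u v \<and> v = P @ branch v u"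
proof (induction u v rule: branch.induct)
  case (1 x u y v)
  show ?case
  proof (cases "x = y")
    case True
    with 1 obtain P where "u = P @ branch u v" "v = P @ branch v u" by blast
    with True have "x # u = (x # P) @ branch (x # u) (y # v) \<and> y # v = (x # P) @ branch (y # v) (x # u)"
      by simp
    then show ?thesis by blast
  qed simp
qed (auto; case_tac v; simp)+

lemma branch_append: "branch (P @ u) (P @ v) = branch u v"
  by (induction P) auto

lemma branch_heads_differ:
  assumes "u = [] \<or> v = [] \<or> hd u \<noteq> hd v"
  shows "branch u v = u"
  using assms by (cases u; cases v) auto

lemma branch_disjoint:
  assumes "set u \<inter> set v = {}"
  shows "branch (P @ u) (P @ v) = u"
proof -
  have "u = [] \<or> v = [] \<or> hd u \<noteq> hd v"
    using assms by (cases u; cases v) auto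
  then show ?thesis by (simp add: branch_append branch_heads_differ)
qed

lemma tree_dist_Nil [simp]: "tree_dist [] v = length v" "tree_dist u [] = length u"
  by (cases v; simp add: tree_dist_def) (cases u; simp add: tree_dist_def)

lemma tree_dist_Cons [simp]:
  "tree_dist (x # u) (y # v) = (if x = y then tree_dist u v else length u + length v + 2)"
  by (simp add: tree_dist_def)

lemma tree_dist_self [simp]: "tree_dist u u = 0"
  by (induction u) auto

lemma tree_dist_append [simp]: "tree_dist (P @ u) (P @ v) = tree_dist u v"
  by (simp add: tree_dist_def branch_append)

lemma tree_dist_le: "tree_dist u v \<le> length u + length v"
  by (induction u v rule: branch.induct) auto

lemma tree_dist_ge: "length v \<le> length u + tree_dist u v"
  by (induction u v rule: branch.induct) auto

lemma tree_dist_snoc: "\<bar>int (tree_dist u (v @ [x])) - int (tree_dist u v)\<bar> \<le> 1"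
proof (induction u v rule: branch.induct)
  case ("2_1" v)
  show ?case by simp
next
  case ("2_2" u)
  show ?case by (cases u) auto
qed auto

lemma tree_dist_map_le: "tree_dist (map f xs) (map f ys) \<le> tree_dist xs ys"
proof (induction xs ys rule: branch.induct)
  case (1 x u y v)
  then show ?case using tree_dist_le[of "map f u" "map f v"] by auto
qed auto

section \<open>Paths without backtracking in a tree\<close>

text \<open>
  A step of a path in the tree: walk back over the edge \<open>r\<close> if it leads to the root, otherwise
  walk away from the root along it.
\<close>

definition toggle :: "'x \<Rightarrow> 'x list \<Rightarrow> 'x list" where
  "toggle r L = (if L \<noteq> [] \<and> last L = r then butlast L else L @ [r])"

text \<open>
  Without the hypothesis, walking back over the last of two equal letters would not be undone by the
  second step, which would walk back again.
\<close>

lemma toggle_toggle: "distinct_adj L \<Longrightarrow> toggle r (toggle r L) = L"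
proof (cases "L \<noteq> [] \<and> last L = r")
  case True
  moreover assume "distinct_adj L"
  ultimately obtain L' where L: "L = L' @ [r]" by (metis append_butlast_last_id)
  with \<open>distinct_adj L\<close> have "L' = [] \<or> last L' \<noteq> r"
    by (auto simp: distinct_adj_append_iff)
  then show ?thesis using L by (auto simp: toggle_def)
qed (auto simp: toggle_def)

lemma distinct_adj_toggle: "distinct_adj L \<Longrightarrow> distinct_adj (toggle r L)"
proof (cases "L \<noteq> [] \<and> last L = r")
  case True
  then obtain L' where "L = L' @ [r]" by (metis append_butlast_last_id)
  moreover assume "distinct_adj L"
  ultimately show ?thesis by (simp add: toggle_def distinct_adj_append_iff)
qed (auto simp: toggle_def distinct_adj_append_iff)

lemma distinct_adj_fold_toggle: "distinct_adj L \<Longrightarrow> distinct_adj (fold toggle rs L)"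
  by (induction rs arbitrary: L) (auto simp: distinct_adj_toggle)

lemma mem_toggle: "r' \<noteq> r \<Longrightarrow> r \<in> set (toggle r' L) \<longleftrightarrow> r \<in> set L"
proof (cases "L \<noteq> [] \<and> last L = r'")
  case True
  then obtain L' where "L = L' @ [r']" by (metis append_butlast_last_id)
  moreover assume "r' \<noteq> r"
  ultimately show ?thesis by (auto simp: toggle_def)
qed (auto simp: toggle_def)

lemma mem_fold_toggle: "r \<notin> set rs \<Longrightarrow> r \<in> set (fold toggle rs L) \<longleftrightarrow> r \<in> set L"
proof (induction rs arbitrary: L)
  case (Cons a rs)
  then have "r \<in> set (fold toggle (a # rs) L) \<longleftrightarrow> r \<in> set (toggle a L)" by simp
  also have "\<dots> \<longleftrightarrow> r \<in> set L" using Cons.prems by (intro mem_toggle) auto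
  finally show ?case .
qed simp

text \<open>
  A path that never uses the same edge label twice is a geodesic: it first walks back along \<open>Q\<close> to the
  branching point \<open>P\<close> and then away from the root along \<open>R\<close>. It cannot turn back on \<open>R\<close> or re-enter \<open>Q\<close>,
  as this would repeat a label.
\<close>

lemma fold_toggle_distinct:
  assumes "distinct rs"
  shows "\<exists>P Q R. L = P @ Q \<and> fold toggle rs L = P @ R \<and> distinct (Q @ R) \<and> set (Q @ R) = set rs"
  using assms
proof (induction rs rule: rev_induct)
  case Nil
  show ?case by (rule exI[of _ L], rule exI[of _ "[]"], rule exI[of _ "[]"]) simp
next
  case (snoc r rs)
  then obtain P Q R where *: "L = P @ Q" "fold toggle rs L = P @ R" "distinct (Q @ R)"
    "set (Q @ R) = set rs" by auto
  have r: "r \<notin> set (Q @ R)" using snoc.prems *(4) by simp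
  show ?case
  proof (cases "R = [] \<and> P \<noteq> [] \<and> last P = r")
    case True
    then obtain P' where P: "P = P' @ [r]" by (metis append_butlast_last_id)
    have "fold toggle (rs @ [r]) L = P' @ []" using *(2) True P by (simp add: toggle_def)
    moreover have "L = P' @ (r # Q)" using *(1) P by simp
    moreover have "distinct ((r # Q) @ [])" "set ((r # Q) @ []) = set (rs @ [r])"
      using *(3,4) r True by auto
    ultimately show ?thesis by blast
  next
    case False
    have "P @ R = [] \<or> last (P @ R) \<noteq> r"
    proof (cases "R = []")
      case False
      then have "last R \<in> set (Q @ R)" by simp
      then have "last R \<noteq> r" using r by auto
      then show ?thesis using False by simp
    qed (use \<open>\<not> (R = [] \<and> P \<noteq> [] \<and> last P = r)\<close> in auto)
    then have "fold toggle (rs @ [r]) L = P @ (R @ [r])" using *(2) by (auto simp: toggle_def)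
    moreover have "distinct (Q @ (R @ [r]))" "set (Q @ (R @ [r])) = set (rs @ [r])"
      using *(3,4) r by auto
    ultimately show ?thesis using *(1) by blast
  qed
qed

section \<open>Labels as binary words\<close>

text \<open>
  A code by words of equal length \<open>M\<close>, so that codes of different labels branch within \<open>M\<close> steps.
\<close>

definition label_code :: "nat \<Rightarrow> nat \<Rightarrow> bool list" where
  "label_code M k = replicate k True @ replicate (M - k) False"

lemma length_label_code: "k < M \<Longrightarrow> length (label_code M k) = M"
  by (simp add: label_code_def)

lemma label_code_neq: "k < l \<Longrightarrow> l < M \<Longrightarrow> label_code M k \<noteq> label_code M l"
proof
  assume *: "k < l" "l < M" and "label_code M k = label_code M l"
  then have "label_code M k ! k = label_code M l ! k" by simp
  then show False using * by (simp add: label_code_def nth_append)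
qed

lemma inj_label_code: "inj_on (label_code M) {..<M}"
  by (rule linorder_inj_onI) (auto simp: label_code_neq)

lemma tree_dist_append_neq:
  assumes "length p = length q" "p \<noteq> q"
  shows "length u + length v + 2 \<le> tree_dist (p @ u) (q @ v)"
  using assms by (induction p q rule: list_induct2) auto

definition encode :: "nat \<Rightarrow> nat list \<Rightarrow> bool list" where
  "encode M xs = concat (map (label_code M) xs)"

lemma length_encode: "set xs \<subseteq> {..<M} \<Longrightarrow> length (encode M xs) = M * length xs"
  by (induction xs) (auto simp: encode_def length_label_code)

text \<open>
  The first pair of different labels may have codes with a long common prefix. This happens only
  once, so at most \<open>2 * M\<close> of the distance is lost.
\<close>

lemma tree_dist_encode_ge:
  assumes "set xs \<subseteq> {..<M}" "set ys \<subseteq> {..<M}"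
  shows "M * tree_dist xs ys \<le> tree_dist (encode M xs) (encode M ys) + 2 * M"
  using assms
proof (induction xs ys rule: branch.induct)
  case (1 x u y v)
  show ?case
  proof (cases "x = y")
    case True
    then show ?thesis using 1 by (simp add: encode_def)
  next
    case False
    have "label_code M x \<noteq> label_code M y"
      using False 1(2,3) inj_label_code by (auto simp: inj_on_def)
    moreover have "length (label_code M x) = length (label_code M y)"
      using 1(2,3) by (simp add: length_label_code)
    ultimately have "length (encode M u) + length (encode M v) + 2
        \<le> tree_dist (encode M (x # u)) (encode M (y # v))"
      using tree_dist_append_neq[of "label_code M x" "label_code M y"] by (simp add: encode_def)
    then show ?thesis
      using 1(2,3) False by (simp add: length_encode algebra_simps)
  qed
next
  case ("2_1" v)
  then show ?case using length_encode[OF "2_1"(2)] by (simp add: encode_def)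
next
  case ("2_2" v)
  then show ?case using length_encode[OF "2_2"(1)] by (simp add: encode_def)
qed

lemma tree_dist_encode_le:
  assumes "set xs \<subseteq> {..<M}" "set ys \<subseteq> {..<M}"
  shows "tree_dist (encode M xs) (encode M ys) \<le> M * tree_dist xs ys"
  using assms
proof (induction xs ys rule: branch.induct)
  case (1 x u y v)
  have "tree_dist (encode M (x # u)) (encode M (y # v)) \<le> M * length (x # u) + M * length (y # v)"
    using tree_dist_le[of "encode M (x # u)" "encode M (y # v)"] 1(2,3)[THEN length_encode] by linarith
  moreover have "tree_dist (encode M (x # u)) (encode M (y # v)) = tree_dist (encode M u) (encode M v)" if "x = y"
    using that by (simp add: encode_def)
  ultimately show ?case using 1 by (auto simp: algebra_simps)
next
  case ("2_1" v)
  then show ?case using length_encode[OF "2_1"(2)] by (simp add: encode_def)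
next
  case ("2_2" v)
  then show ?case using length_encode[OF "2_2"(1)] by (simp add: encode_def)
qed


section \<open>Geometric realizations of graphs\<close>

definition vertex_point :: "'v \<Rightarrow> 'v \<Rightarrow> real" where
  "vertex_point v = (\<lambda>x. if x = v then 1 else 0)"

text \<open>
  The affine extension of a function on the vertices to the barycentric coordinates. It bounds
  lengths of paths from below: extensions of 1-Lipschitz functions are 1-Lipschitz.
\<close>

definition linear_extension :: "('v \<Rightarrow> real) \<Rightarrow> ('v \<Rightarrow> real) \<Rightarrow> real" where
  "linear_extension \<phi> p = (\<Sum>v | p v \<noteq> 0. p v * \<phi> v)"

lemma finite_cell: "p \<in> cell_points \<sigma> \<Longrightarrow> finite \<sigma>"
  unfolding cell_points_def by (rule ccontr) simp

lemma linear_extension_cell: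
  assumes "p \<in> cell_points \<sigma>"
  shows "linear_extension \<phi> p = (\<Sum>v\<in>\<sigma>. p v * \<phi> v)"
  unfolding linear_extension_def
proof (rule sum.mono_neutral_left)
  show "finite \<sigma>" using assms by (rule finite_cell)
  show "{v. p v \<noteq> 0} \<subseteq> \<sigma>" using assms by (auto simp: cell_points_def)
qed auto

lemma linear_extension_near:
  assumes p: "p \<in> cell_points \<sigma>" and "\<And>v. v \<in> \<sigma> \<Longrightarrow> \<bar>\<phi> v - m\<bar> \<le> d"
  shows "\<bar>linear_extension \<phi> p - m\<bar> \<le> d"
proof -
  have s: "(\<Sum>v\<in>\<sigma>. p v) = 1" and nn: "\<And>v. 0 \<le> p v" using p by (auto simp: cell_points_def)
  have "linear_extension \<phi> p - m = (\<Sum>v\<in>\<sigma>. p v * \<phi> v) - (\<Sum>v\<in>\<sigma>. p v) * m"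
    using s by (simp add: linear_extension_cell[OF p])
  also have "\<dots> = (\<Sum>v\<in>\<sigma>. p v * (\<phi> v - m))"
    by (simp add: sum_distrib_left algebra_simps sum_subtractf)
  also have "\<bar>\<dots>\<bar> \<le> (\<Sum>v\<in>\<sigma>. \<bar>p v * (\<phi> v - m)\<bar>)" by (rule sum_abs)
  also have "\<dots> \<le> (\<Sum>v\<in>\<sigma>. p v * d)"
    by (intro sum_mono) (auto simp: abs_mult nn assms(2) intro: mult_left_mono)
  also have "\<dots> = d" using s by (simp flip: sum_distrib_right)
  finally show ?thesis .
qed

lemma linear_extension_vertex: "linear_extension \<phi> (vertex_point v) = \<phi> v"
proof -
  have "vertex_point v \<in> cell_points {v}" by (auto simp: cell_points_def vertex_point_def)
  from linear_extension_cell[OF this] show ?thesis by (simp add: vertex_point_def)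
qed

text \<open>
  On one cell, the values of \<open>\<phi>\<close> may be shifted by the constant \<open>m\<close>, since the coordinates of both
  ends of a segment sum to 1. After the shift they are at most 1/2, which matches the factor 1/2 in
  the length of a segment.
\<close>

lemma graph_path_ge_linear_extension:
  assumes "graph_path V E p q l"
    and osc: "\<And>\<sigma>. \<sigma> \<in> graph_cells V E \<Longrightarrow> \<exists>m. \<forall>v\<in>\<sigma>. \<bar>\<phi> v - m\<bar> \<le> 1/2"
  shows "\<bar>linear_extension \<phi> q - linear_extension \<phi> p\<bar> \<le> l"
  using assms(1)
proof induction
  case (segment p q l \<sigma> r)
  obtain m where m: "\<And>v. v \<in> \<sigma> \<Longrightarrow> \<bar>\<phi> v - m\<bar> \<le> 1/2" using osc segment by blast
  have s: "(\<Sum>v\<in>\<sigma>. q v) = 1" "(\<Sum>v\<in>\<sigma>. r v) = 1" using segment by (auto simp: cell_points_def)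
  have "linear_extension \<phi> r - linear_extension \<phi> q = (\<Sum>v\<in>\<sigma>. r v * \<phi> v) - (\<Sum>v\<in>\<sigma>. q v * \<phi> v)
      - ((\<Sum>v\<in>\<sigma>. r v) - (\<Sum>v\<in>\<sigma>. q v)) * m"
    using segment s by (simp add: linear_extension_cell)
  also have "\<dots> = (\<Sum>v\<in>\<sigma>. (r v - q v) * (\<phi> v - m))"
    by (simp add: sum_distrib_left algebra_simps sum_subtractf sum.distrib)
  also have "\<bar>\<dots>\<bar> \<le> (\<Sum>v\<in>\<sigma>. \<bar>(r v - q v) * (\<phi> v - m)\<bar>)" by (rule sum_abs)
  also have "\<dots> \<le> (\<Sum>v\<in>\<sigma>. \<bar>q v - r v\<bar> * (1/2))"
    unfolding abs_mult abs_minus_commute[of "r _"] by (intro sum_mono mult_left_mono m) auto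
  also have "\<dots> = (\<Sum>v\<in>\<sigma>. \<bar>q v - r v\<bar>) / 2" by (simp add: sum_divide_distrib)
  finally show ?case using segment.IH by linarith
qed simp

inductive graph_walk :: "'v set set \<Rightarrow> nat \<Rightarrow> 'v \<Rightarrow> 'v \<Rightarrow> bool" for E :: "'v set set" where
  stay: "graph_walk E 0 u u"
| step: "graph_walk E k u v \<Longrightarrow> {v, w} \<in> E \<Longrightarrow> graph_walk E (Suc k) u w"

lemma graph_walk_trans:
  assumes "graph_walk E l v w" "graph_walk E k u v"
  shows "graph_walk E (k + l) u w"
  using assms by induction (auto intro: graph_walk.intros)

lemma graph_walk_sym:
  assumes "graph_walk E k u v"
  shows "graph_walk E k v u"
  using assms
proof induction
  case (step k u v w)
  have "graph_walk E (Suc 0) w v"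
    using step.hyps by (intro graph_walk.step[OF graph_walk.stay]) (simp add: insert_commute)
  from graph_walk_trans[OF step.IH this] show ?case by simp
qed (rule graph_walk.stay)

text \<open>
  A combinatorial description of the metric of a connected graph: \<open>D\<close> is a path metric if it changes
  by at most one along an edge and is realized by walks.
\<close>

locale path_metric_graph =
  fixes V :: "'v set" and E :: "'v set set" and D :: "'v \<Rightarrow> 'v \<Rightarrow> nat"
  assumes edge: "e \<in> E \<Longrightarrow> \<exists>u\<in>V. \<exists>v\<in>V. u \<noteq> v \<and> e = {u, v}"
    and D_self: "u \<in> V \<Longrightarrow> D u u = 0"
    and D_edge: "u \<in> V \<Longrightarrow> {v, w} \<in> E \<Longrightarrow> D u w \<le> D u v + 1"
    and D_walk: "u \<in> V \<Longrightarrow> v \<in> V \<Longrightarrow> graph_walk E (D u v) u v"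
begin

lemma cell_le_one:
  assumes "\<sigma> \<in> graph_cells V E" "u \<in> V" "v \<in> \<sigma>" "w \<in> \<sigma>"
  shows "D u w \<le> D u v + 1"
  using assms edge[of \<sigma>] D_edge[of u v w] by (force simp: graph_cells_def insert_commute)

lemma cell_subset: "\<sigma> \<in> graph_cells V E \<Longrightarrow> \<sigma> \<subseteq> V"
  using edge by (force simp: graph_cells_def)

text \<open>
  The lower bound comes from the extension of the distance to the vertex \<open>u\<close>; on an edge, its values
  deviate by at most 1/2 from their mean.
\<close>

lemma graph_path_ge:
  assumes "graph_path V E p q l" "u \<in> V"
  shows "linear_extension (\<lambda>v. real (D u v)) q - linear_extension (\<lambda>v. real (D u v)) p \<le> l"
proof -
  have "\<exists>m. \<forall>v\<in>\<sigma>. \<bar>real (D u v) - m\<bar> \<le> 1/2" if \<sigma>: "\<sigma> \<in> graph_cells V E" for \<sigma>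
  proof -
    obtain a b where ab: "\<sigma> = {a, b}"
      using \<sigma> edge unfolding graph_cells_def by (metis UnE imageE insert_absorb2)
    have "D u a \<le> D u b + 1" "D u b \<le> D u a + 1" using cell_le_one[OF \<sigma> \<open>u \<in> V\<close>] ab by auto
    then have "\<forall>v\<in>\<sigma>. \<bar>real (D u v) - (real (D u a) + real (D u b)) / 2\<bar> \<le> 1/2"
      unfolding ab by (auto simp: abs_le_iff field_simps)
    then show ?thesis by blast
  qed
  from graph_path_ge_linear_extension[OF assms(1) this]
  show ?thesis by linarith
qed

lemma vertex_point_in_cell: "finite \<sigma> \<Longrightarrow> v \<in> \<sigma> \<Longrightarrow> vertex_point v \<in> cell_points \<sigma>"
  by (auto simp: cell_points_def vertex_point_def)

lemma finite_graph_cell: "\<sigma> \<in> graph_cells V E \<Longrightarrow> finite \<sigma>"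
  using edge by (force simp: graph_cells_def)

lemma vertex_point_in_graph: "v \<in> V \<Longrightarrow> vertex_point v \<in> graph_points V E"
  using vertex_point_in_cell[of "{v}" v] by (auto simp: graph_points_def graph_cells_def)

lemma graph_path_walk:
  assumes "graph_walk E k u v" "graph_path V E p (vertex_point u) l"
  shows "graph_path V E p (vertex_point v) (l + k)"
  using assms
proof induction
  case (step k u v w)
  have "v \<noteq> w" using edge[OF step.hyps(2)] by auto
  have \<sigma>: "{v, w} \<in> graph_cells V E" using step.hyps by (simp add: graph_cells_def)
  have "graph_path V E p (vertex_point w)
      (l + k + (\<Sum>x\<in>{v,w}. \<bar>vertex_point v x - vertex_point w x\<bar>) / 2)"
    by (rule graph_path.segment[OF step.IH[OF step.prems] \<sigma>]) (auto intro: vertex_point_in_cell)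
  then show ?case using \<open>v \<noteq> w\<close> by (simp add: vertex_point_def algebra_simps)
qed simp

lemma segment_le_one:
  assumes "p \<in> cell_points \<sigma>" "q \<in> cell_points \<sigma>"
  shows "(\<Sum>v\<in>\<sigma>. \<bar>p v - q v\<bar>) / 2 \<le> 1"
proof -
  have "(\<Sum>v\<in>\<sigma>. \<bar>p v - q v\<bar>) \<le> (\<Sum>v\<in>\<sigma>. p v + q v)"
    using assms by (intro sum_mono) (auto simp: cell_points_def abs_le_iff add_nonneg_nonneg)
  also have "\<dots> = 2" using assms by (simp add: cell_points_def sum.distrib)
  finally show ?thesis by simp
qed

lemma bdd_below_graph_path: "bdd_below {l. graph_path V E p q l}"
proof (rule bdd_belowI)
  fix l assume "l \<in> {l. graph_path V E p q l}"
  then have "\<bar>linear_extension (\<lambda>_. 0) q - linear_extension (\<lambda>_. 0) p\<bar> \<le> l"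
    by (intro graph_path_ge_linear_extension[of V E p q l]) (auto intro: exI[of _ 0])
  then show "0 \<le> l" by linarith
qed

lemma graph_dist_le: "graph_path V E p q l \<Longrightarrow> graph_dist V E p q \<le> l"
  unfolding graph_dist_def using bdd_below_graph_path by (auto intro: cInf_lower)

lemma graph_path_near_vertices:
  assumes "p \<in> cell_points \<sigma>" "\<sigma> \<in> graph_cells V E" "u \<in> \<sigma>"
    and "q \<in> cell_points \<tau>" "\<tau> \<in> graph_cells V E" "v \<in> \<tau>"
  shows "\<exists>l. graph_path V E p q l \<and> l \<le> D u v + 2"
proof -
  have uv: "u \<in> V" "v \<in> V" using assms cell_subset by auto
  have "p \<in> graph_points V E" using assms by (auto simp: graph_points_def)
  from graph_path.segment[OF graph_path.start[OF this] assms(2,1) vertex_point_in_cell[OF finite_graph_cell[OF assms(2)] assms(3)]]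
  have "graph_path V E p (vertex_point u) ((\<Sum>x\<in>\<sigma>. \<bar>p x - vertex_point u x\<bar>) / 2)" by simp
  from graph_path.segment[OF graph_path_walk[OF D_walk[OF uv] this] assms(5)
      vertex_point_in_cell[OF finite_graph_cell[OF assms(5)] assms(6)] assms(4)]
  show ?thesis
    using segment_le_one[OF assms(1) vertex_point_in_cell[OF finite_graph_cell[OF assms(2)] assms(3)]]
      segment_le_one[OF vertex_point_in_cell[OF finite_graph_cell[OF assms(5)] assms(6)] assms(4)]
    by force
qed

lemma graph_dist_near_vertices:
  assumes "p \<in> cell_points \<sigma>" "\<sigma> \<in> graph_cells V E" "u \<in> \<sigma>"
    and "q \<in> cell_points \<tau>" "\<tau> \<in> graph_cells V E" "v \<in> \<tau>"
  shows "\<bar>graph_dist V E p q - D u v\<bar> \<le> 2"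
proof -
  let ?\<phi> = "linear_extension (\<lambda>v. real (D u v))"
  have uv: "u \<in> V" "v \<in> V" using assms cell_subset by auto
  obtain l where l: "graph_path V E p q l" "l \<le> D u v + 2"
    using graph_path_near_vertices[OF assms] by blast
  have p: "\<bar>?\<phi> p - D u u\<bar> \<le> 1"
    using cell_le_one[OF assms(2) uv(1)] assms(3)
    by (intro linear_extension_near[OF assms(1)]) (force simp: abs_le_iff)
  have q: "\<bar>?\<phi> q - D u v\<bar> \<le> 1"
    using cell_le_one[OF assms(5) uv(1)] assms(6)
    by (intro linear_extension_near[OF assms(4)]) (force simp: abs_le_iff)
  have "real (D u v) - 2 \<le> graph_dist V E p q"
    unfolding graph_dist_def
  proof (rule cInf_greatest)
    fix l assume "l \<in> {l. graph_path V E p q l}"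
    then show "real (D u v) - 2 \<le> l" using graph_path_ge[of p q l u] uv p q D_self by auto
  qed (use l in auto)
  then show ?thesis using graph_dist_le[OF l(1)] l(2) by linarith
qed

lemma graph_dist_vertices:
  assumes "u \<in> V" "v \<in> V"
  shows "graph_dist V E (vertex_point u) (vertex_point v) = D u v"
proof (rule antisym)
  have *: "graph_path V E (vertex_point u) (vertex_point v) (D u v)"
    using graph_path_walk[OF D_walk[OF assms] graph_path.start[OF vertex_point_in_graph]] assms by simp
  then show "graph_dist V E (vertex_point u) (vertex_point v) \<le> D u v" by (rule graph_dist_le)
  show "D u v \<le> graph_dist V E (vertex_point u) (vertex_point v)"
    unfolding graph_dist_def
  proof (rule cInf_greatest)
    fix l assume "l \<in> {l. graph_path V E (vertex_point u) (vertex_point v) l}"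
    then show "D u v \<le> l"
      using graph_path_ge[of "vertex_point u" "vertex_point v" l u] assms by (auto simp: linear_extension_vertex D_self)
  qed (use * in blast)
qed

end

section \<open>The binary tree\<close>

lemma binary_tree_edge_Cons: "e \<in> binary_tree_edges \<Longrightarrow> (#) x ` e \<in> binary_tree_edges"
  by (auto simp: binary_tree_edges_def)

lemma graph_walk_Cons:
  "graph_walk binary_tree_edges k u v \<Longrightarrow> graph_walk binary_tree_edges k (x # u) (x # v)"
proof (induction rule: graph_walk.induct)
  case (step k u v w)
  show ?case
    using binary_tree_edge_Cons[OF step.hyps(2), of x] by (intro graph_walk.step[OF step.IH]) simp
qed (rule graph_walk.stay)

lemma graph_walk_root: "graph_walk binary_tree_edges (length v) [] v"
proof (induction v rule: rev_induct)
  case (snoc x v)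
  have "{v, v @ [x]} \<in> binary_tree_edges"
    unfolding binary_tree_edges_def by (auto intro!: exI[of _ "v @ [x]"])
  from graph_walk.step[OF snoc.IH this] show ?case by simp
qed (simp add: graph_walk.stay)

lemma graph_walk_tree_dist: "graph_walk binary_tree_edges (tree_dist u v) u v"
proof (induction u v rule: branch.induct)
  case (1 x u y v)
  have "graph_walk binary_tree_edges (length (x # u) + length (y # v)) (x # u) (y # v)"
    by (rule graph_walk_trans[OF graph_walk_root graph_walk_sym[OF graph_walk_root]])
  then show ?case using 1 graph_walk_Cons by auto
qed (use graph_walk_root graph_walk_sym[OF graph_walk_root] in auto)

interpretation binary_tree: path_metric_graph UNIV binary_tree_edges tree_dist
proof
  fix e :: "bool list set" assume "e \<in> binary_tree_edges"
  then obtain w :: "bool list" where "w \<noteq> []" "e = {w, butlast w}"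
    by (auto simp: binary_tree_edges_def)
  moreover have "w \<noteq> butlast w"
    using \<open>w \<noteq> []\<close> by (metis append_butlast_last_id append_self_conv list.discI)
  ultimately show "\<exists>u\<in>UNIV. \<exists>v\<in>UNIV. u \<noteq> v \<and> e = {u, v}" by blast
next
  fix u v w :: "bool list" assume "{v, w} \<in> binary_tree_edges"
  then obtain z where "z \<noteq> []" "{v, w} = {z, butlast z}" by (auto simp: binary_tree_edges_def)
  then consider "v = w @ [last v]" | "w = v @ [last w]"
    by (auto simp: doubleton_eq_iff)
  then show "tree_dist u w \<le> tree_dist u v + 1"
    by cases (use tree_dist_snoc[of u w "last v"] tree_dist_snoc[of u v "last w"] in \<open>auto simp: abs_le_iff\<close>)
qed (auto simp: graph_walk_tree_dist)

section \<open>Labellings that separate pairs of lists\<close>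

text \<open>
  The labellings of \<open>X\<close> by \<open>M\<close> labels that distinguish the two lists of each pair inside \<open>X\<close>. They are
  extensional functions so that they can be counted.
\<close>

definition separating :: "('x list \<times> 'x list) set \<Rightarrow> nat \<Rightarrow> 'x set \<Rightarrow> ('x \<Rightarrow> nat) set" where
  "separating E M X = {c \<in> PiE X (\<lambda>_. {..<M}).
     \<forall>(U, V)\<in>E. set U \<union> set V \<subseteq> X \<longrightarrow> map c U \<noteq> map c V}"

text \<open>
  The sparseness condition of the local lemma: the number of pairs of size \<open>N\<close> through a point grows
  at most exponentially in \<open>N\<close>, and so does the number of ways to label one of the lists.
\<close>

locale sparse_pairs =
  fixes E :: "('x list \<times> 'x list) set" and B :: nat
  assumes pair_sym: "(U, V) \<in> E \<Longrightarrow> (V, U) \<in> E"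
    and pair_length: "(U, V) \<in> E \<Longrightarrow> length U = length V"
    and pair_distinct: "(U, V) \<in> E \<Longrightarrow> distinct U"
    and pair_disjoint: "(U, V) \<in> E \<Longrightarrow> set U \<inter> set V = {}"
    and finite_through: "finite {(U, V) \<in> E. x \<in> set U \<and> length U = N}"
    and card_through: "N \<ge> 1 \<Longrightarrow> card {(U, V) \<in> E. x \<in> set U \<and> length U = N} \<le> B ^ N"
    and pair_nonempty: "(U, V) \<in> E \<Longrightarrow> U \<noteq> []"
    and B_pos: "B \<ge> 1"
begin

abbreviation Sep :: "'x set \<Rightarrow> ('x \<Rightarrow> nat) set" where "Sep \<equiv> separating E (4 * B)"

lemma finite_Sep: "finite X \<Longrightarrow> finite (Sep X)"
  unfolding separating_def by (rule finite_subset[OF Collect_subset]) (auto intro: finite_PiE)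

lemma Sep_restrict: "c \<in> Sep X \<Longrightarrow> Y \<subseteq> X \<Longrightarrow> restrict c Y \<in> Sep Y"
proof -
  assume c: "c \<in> Sep X" and "Y \<subseteq> X"
  have "map (restrict c Y) U \<noteq> map (restrict c Y) V"
    if "(U, V) \<in> E" "set U \<subseteq> Y" "set V \<subseteq> Y" for U V
  proof -
    have "map (restrict c Y) U = map c U" "map (restrict c Y) V = map c V"
      using that by (auto intro: map_cong)
    moreover have "map c U \<noteq> map c V" using c that \<open>Y \<subseteq> X\<close> unfolding separating_def by fast
    ultimately show ?thesis by metis
  qed
  then show ?thesis using c \<open>Y \<subseteq> X\<close> by (auto simp: separating_def PiE_iff)
qed

text \<open>
  If \<open>U\<close> and \<open>V\<close> carry equal labels, then the labels on \<open>U\<close> are determined by those outside of \<open>U\<close>, as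
  \<open>V\<close> is disjoint from \<open>U\<close>.
\<close>

lemma card_Sep_collision:
  assumes UV: "(U, V) \<in> E" and sub: "set U \<union> set V \<subseteq> Y" and "finite Y"
  shows "card {c \<in> PiE Y (\<lambda>_. {..<4 * B}). restrict c (Y - set U) \<in> Sep (Y - set U) \<and> map c U = map c V}
    \<le> card (Sep (Y - set U))" (is "card ?A \<le> _")
proof (rule card_inj_on_le)
  show "inj_on (\<lambda>c. restrict c (Y - set U)) ?A"
  proof (rule inj_onI)
    fix c \<mu> assume l: "c \<in> ?A" "\<mu> \<in> ?A" and eq: "restrict c (Y - set U) = restrict \<mu> (Y - set U)"
    have out: "c y = \<mu> y" if "y \<in> Y - set U" for y
      using fun_cong[OF eq, of y] that by simp
    have "set V \<subseteq> Y - set U" using pair_disjoint[OF UV] sub by auto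
    then have "map c V = map \<mu> V" using out by (auto intro: map_cong)
    then have "map c U = map \<mu> U" using l by auto
    then have "c y = \<mu> y" if "y \<in> set U" for y using that by (auto simp: map_eq_conv)
    then have "c y = \<mu> y" if "y \<in> Y" for y using out that by blast
    then show "c = \<mu>" using l by (auto intro: PiE_ext)
  qed
qed (use finite_Sep \<open>finite Y\<close> in auto)

text \<open>
  Rosenfeld's induction: each further point multiplies the number of good labellings by at least
  \<open>2 * B\<close>. Of the \<open>4 * B\<close> extensions of each good labelling of \<open>X\<close>, those are lost that create a
  collision in a pair through \<open>x\<close>. A collision of size \<open>N\<close> fixes the labels of \<open>N\<close> points, including
  \<open>x\<close>, so by the induction hypothesis applied \<open>N - 1\<close> times it loses at most the fraction
  \<open>(2 * B)\<^sup>-\<^sup>N\<^sup>+\<^sup>1\<close> of the number of good labellings of \<open>X\<close>. With \<open>B\<^sup>N\<close> pairs of size \<open>N\<close>, the losses sum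
  up to at most \<open>2 * B\<close> times this number.
\<close>

lemma card_Sep_insert:
  assumes "finite X" "x \<notin> X"
  shows "2 * B * card (Sep X) \<le> card (Sep (insert x X))"
  using assms
proof (induction "card X" arbitrary: X x rule: less_induct)
  case less
  let ?Y = "insert x X"
  let ?T = "\<lambda>N. {(U, V) \<in> E. x \<in> set U \<and> length U = N}"
  let ?T' = "\<lambda>N. {(U, V) \<in> ?T N. set U \<union> set V \<subseteq> ?Y}"
  let ?A = "\<lambda>(U, V). {c \<in> PiE ?Y (\<lambda>_. {..<4 * B}). restrict c (?Y - set U) \<in> Sep (?Y - set U) \<and> map c U = map c V}"
  let ?All = "{c \<in> PiE ?Y (\<lambda>_. {..<4 * B}). restrict c X \<in> Sep X}"
  have fin: "finite ?Y" using less.prems by simp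
  \<comment> \<open>The induction hypothesis, used to remove \<open>k\<close> points one by one.\<close>
  have remove: "(2 * B) ^ k * card (Sep (X - Z)) \<le> card (Sep X)"
    if "Z \<subseteq> X" "card Z = k" for Z k
    using finite_subset[OF that(1) less.prems(1)] that
  proof (induction Z arbitrary: k rule: finite_induct)
    case (insert z Z)
    have "card (X - insert z Z) < card X"
      using insert less.prems by (intro psubset_card_mono) auto
    then have "2 * B * card (Sep (X - insert z Z)) \<le> card (Sep (insert z (X - insert z Z)))"
      using less.prems by (intro less.hyps) auto
    also have "insert z (X - insert z Z) = X - Z" using insert by auto
    finally have "(2 * B) ^ card Z * (2 * B * card (Sep (X - insert z Z))) \<le> (2 * B) ^ card Z * card (Sep (X - Z))"
      by (rule mult_le_mono2)
    also have "\<dots> \<le> card (Sep X)" using insert by auto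
    finally show ?case using insert.prems(2) insert.hyps by (auto simp: mult_ac)
  qed simp
  \<comment> \<open>The \<open>4 * B\<close> ways to extend each good labelling of \<open>X\<close>.\<close>
  have all: "card ?All = 4 * B * card (Sep X)"
  proof -
    have "bij_betw (\<lambda>(k, c). c(x := k)) ({..<4 * B} \<times> Sep X) ?All"
    proof (rule bij_betw_byWitness[where f' = "\<lambda>c. (c x, restrict c X)"])
      have r: "restrict (c(x := k)) X = c" if "c \<in> Sep X" for c k
        using that less.prems(2) by (auto simp: separating_def PiE_iff restrict_def extensional_def fun_eq_iff)
      show "\<forall>a\<in>{..<4 * B} \<times> Sep X. ((case a of (k, c) \<Rightarrow> c(x := k)) x, restrict (case a of (k, c) \<Rightarrow> c(x := k)) X) = a"
        using r by auto
      show "\<forall>c\<in>?All. (case (c x, restrict c X) of (k, c) \<Rightarrow> c(x := k)) = c"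
        by (auto simp: fun_eq_iff PiE_iff extensional_def)
      show "(\<lambda>(k, c). c(x := k)) ` ({..<4 * B} \<times> Sep X) \<subseteq> ?All"
        using r by (auto simp: separating_def PiE_iff extensional_def)
      show "(\<lambda>c. (c x, restrict c X)) ` ?All \<subseteq> {..<4 * B} \<times> Sep X"
        by auto
    qed
    from bij_betw_same_card[OF this] show ?thesis by (simp add: card_cartesian_product)
  qed
  have cover: "?All \<subseteq> Sep ?Y \<union> (\<Union>N\<in>{1..card ?Y}. \<Union>p\<in>?T' N. ?A p)"
  proof
    fix c assume c: "c \<in> ?All"
    show "c \<in> Sep ?Y \<union> (\<Union>N\<in>{1..card ?Y}. \<Union>p\<in>?T' N. ?A p)"
    proof (cases "c \<in> Sep ?Y")
      case False
      then obtain U V where UV: "(U, V) \<in> E" "set U \<union> set V \<subseteq> ?Y" "map c U = map c V"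
        using c by (auto simp: separating_def)
      have "x \<in> set U \<union> set V"
      proof (rule ccontr)
        assume "x \<notin> set U \<union> set V"
        then have s: "set U \<union> set V \<subseteq> X" using UV by auto
        then have "map (restrict c X) U = map c U" "map (restrict c X) V = map c V"
          by (auto intro: map_cong)
        then show False using c UV s by (auto simp: separating_def)
      qed
      then obtain U V where UV: "(U, V) \<in> E" "set U \<union> set V \<subseteq> ?Y" "map c U = map c V" "x \<in> set U"
        using UV pair_sym[OF UV(1)] by (metis Un_commute Un_iff)
      have "restrict (restrict c X) (?Y - set U) \<in> Sep (?Y - set U)"
        using c UV by (intro Sep_restrict[of "restrict c X" X]) auto
      moreover have "restrict (restrict c X) (?Y - set U) = restrict c (?Y - set U)"
        using UV by (auto simp: restrict_def fun_eq_iff)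
      ultimately have "c \<in> ?A (U, V)" using c UV by auto
      moreover have "length U \<in> {1..card ?Y}"
      proof -
        have "length U = card (set U)" using pair_distinct[OF UV(1)] by (simp add: distinct_card)
        also have "\<dots> \<le> card ?Y" using UV fin by (intro card_mono) auto
        finally show ?thesis using UV(4) by (cases U) auto
      qed
      moreover have "(U, V) \<in> ?T' (length U)" using UV by auto
      ultimately show ?thesis by blast
    qed simp
  qed
  \<comment> \<open>The loss caused by a single pair of size \<open>N\<close>.\<close>
  have one: "(2 * B) ^ (N - 1) * card (?A p) \<le> card (Sep X)" if "p \<in> ?T' N" for N p
  proof -
    obtain U V where p: "p = (U, V)" by force
    have UV: "(U, V) \<in> E" "x \<in> set U" "length U = N" "set U \<union> set V \<subseteq> ?Y" using that p by auto
    have "card (set U - {x}) = N - 1"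
      using UV pair_distinct[OF UV(1)] by (simp add: distinct_card)
    moreover have "?Y - set U = X - (set U - {x})" using UV less.prems by auto
    moreover have "set U - {x} \<subseteq> X" using UV by auto
    ultimately have "(2 * B) ^ (N - 1) * card (Sep (?Y - set U)) \<le> card (Sep X)"
      using remove[of "set U - {x}" "N - 1"] by simp
    moreover have "card (?A p) \<le> card (Sep (?Y - set U))"
      unfolding p using card_Sep_collision[OF UV(1,4) fin] by simp
    ultimately show ?thesis by (meson le_trans mult_le_mono2)
  qed
  have finA: "finite (?A p)" for p
    by (cases p) (auto intro!: finite_subset[OF Collect_subset] finite_PiE fin)
  have finT: "finite (?T' N)" for N by (rule finite_subset[OF _ finite_through[of x N]]) auto
  \<comment> \<open>The loss caused by all pairs of size \<open>N\<close>.\<close>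
  have level: "real (card (\<Union>p\<in>?T' N. ?A p)) \<le> real B * card (Sep X) * (1/2) ^ (N - 1)"
    if "N \<ge> 1" for N
  proof -
    have "real (card (?A p)) \<le> card (Sep X) / (2 * real B) ^ (N - 1)" if "p \<in> ?T' N" for p
    proof -
      have "real ((2 * B) ^ (N - 1) * card (?A p)) \<le> card (Sep X)"
        using one[OF that] by (simp only: of_nat_le_iff)
      then show ?thesis using B_pos by (simp add: field_simps)
    qed
    then have sum: "(\<Sum>p\<in>?T' N. real (card (?A p))) \<le> card (?T' N) * (card (Sep X) / (2 * real B) ^ (N - 1))"
      by (rule sum_bounded_above)
    have card: "card (?T' N) \<le> B ^ N"
      by (rule le_trans[OF card_mono[OF finite_through[of x N]] card_through[OF that]]) auto
    have "real (card (\<Union>p\<in>?T' N. ?A p)) \<le> real (\<Sum>p\<in>?T' N. card (?A p))"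
      by (rule of_nat_mono[OF card_UN_le[OF finT]])
    also have "\<dots> = (\<Sum>p\<in>?T' N. real (card (?A p)))" by (rule of_nat_sum)
    also note sum
    also have "card (?T' N) * (card (Sep X) / (2 * real B) ^ (N - 1)) \<le> real (B ^ N) * (card (Sep X) / (2 * real B) ^ (N - 1))"
      by (rule mult_right_mono[OF of_nat_mono[OF card]]) simp
    also have "\<dots> = real B * card (Sep X) * (1/2) ^ (N - 1)"
      using that B_pos by (cases N) (auto simp: power_mult_distrib field_simps)
    finally show ?thesis .
  qed
  have "card (\<Union>N\<in>{1..card ?Y}. \<Union>p\<in>?T' N. ?A p) \<le> (\<Sum>N\<in>{1..card ?Y}. card (\<Union>p\<in>?T' N. ?A p))"
    by (rule card_UN_le) simp
  then have "real (card (\<Union>N\<in>{1..card ?Y}. \<Union>p\<in>?T' N. ?A p)) \<le> (\<Sum>N\<in>{1..card ?Y}. real (card (\<Union>p\<in>?T' N. ?A p)))"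
    by (simp only: of_nat_le_iff flip: of_nat_sum)
  also have "\<dots> \<le> (\<Sum>N\<in>{1..card ?Y}. real B * card (Sep X) * (1/2) ^ (N - 1))"
    by (intro sum_mono level) auto
  also have "\<dots> = real B * card (Sep X) * (\<Sum>N\<in>{1..card ?Y}. (1/2) ^ (N - 1))"
    by (simp only: sum_distrib_left)
  also have "(\<Sum>N\<in>{1..card ?Y}. (1/2) ^ (N - 1)) = (\<Sum>N<card ?Y. (1/2::real) ^ N)"
    by (rule sum.reindex_bij_witness[of _ Suc "\<lambda>N. N - 1"]) auto
  also have "real B * card (Sep X) * (\<Sum>N<card ?Y. (1/2::real) ^ N) \<le> real B * card (Sep X) * 2"
    by (intro mult_left_mono) (auto simp: sum_gp_strict)
  finally have bad: "real (card (\<Union>N\<in>{1..card ?Y}. \<Union>p\<in>?T' N. ?A p)) \<le> real B * card (Sep X) * 2" .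
  have "card ?All \<le> card (Sep ?Y \<union> (\<Union>N\<in>{1..card ?Y}. \<Union>p\<in>?T' N. ?A p))"
    using finT finA finite_Sep[OF fin] by (intro card_mono[OF _ cover]) blast
  also have "\<dots> \<le> card (Sep ?Y) + card (\<Union>N\<in>{1..card ?Y}. \<Union>p\<in>?T' N. ?A p)"
    by (rule card_Un_le)
  finally have "real (4 * B * card (Sep X)) \<le> card (Sep ?Y) + real B * card (Sep X) * 2"
    using bad unfolding all by linarith
  then have "real (2 * B * card (Sep X)) \<le> real (card (Sep ?Y))" by simp
  then show ?case by (simp only: of_nat_le_iff)
qed

lemma Sep_nonempty: "finite X \<Longrightarrow> Sep X \<noteq> {}"
proof -
  assume "finite X"
  then have "card (Sep X) > 0"
  proof (induction X rule: finite_induct)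
    case empty
    have "(\<lambda>x. undefined) \<in> Sep {}"
    proof -
      have "U \<noteq> []" if "(U, V) \<in> E" for U V
        using pair_nonempty[OF that] .
      then show ?thesis by (fastforce simp: separating_def)
    qed
    then show ?case using finite_Sep[of "{}"] by (auto simp: card_gt_0_iff)
  next
    case (insert x X)
    have "0 < 2 * B * card (Sep X)" using insert B_pos by simp
    then show ?case using card_Sep_insert[OF insert(1,2)] by linarith
  qed
  then show ?thesis by auto
qed

text \<open>
  Compactness: the labellings of the whole type form a compact space by Tychonoff's theorem, and
  distinguishing the two lists of a pair is a closed condition on finitely many coordinates. Any
  finitely many of these conditions can be satisfied, by counting.
\<close>

lemma exists_separating_labelling:
  "\<exists>c. (\<forall>x. c x < 4 * B) \<and> (\<forall>(U, V)\<in>E. map c U \<noteq> map c V)"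
proof -
  let ?D = "discrete_topology {..<4 * B}"
  let ?T = "product_topology (\<lambda>_::'x. ?D) UNIV"
  let ?C = "\<lambda>(U, V). {c \<in> topspace ?T. map c U \<noteq> map c V}"
  have comp: "compact_space ?T" by (simp add: compact_space_product_topology compact_space_discrete_topology)
  have closed: "closedin ?T (?C p)" if "p \<in> E" for p
  proof -
    obtain U V where p: "p = (U, V)" by force
    have len: "length U = length V" using pair_length that p by auto
    have ev: "openin ?T {c \<in> topspace ?T. c a = c b}" for a b
    proof -
      have "openin ?T {c \<in> topspace ?T. c x = k}" for x k
        using openin_continuous_map_preimage[OF continuous_map_product_projection[of x UNIV "\<lambda>_. ?D"], of "{k} \<inter> {..<4 * B}"]
        by (rule back_subst[of "openin ?T"]) auto
      then have "openin ?T (\<Union>k. {c \<in> topspace ?T. c a = k} \<inter> {c \<in> topspace ?T. c b = k})"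
        by blast
      then show ?thesis by (rule back_subst[of "openin ?T"]) auto
    qed
    have "topspace ?T - ?C p = topspace ?T \<inter> (\<Inter>i\<in>{..<length U}. {c \<in> topspace ?T. c (U ! i) = c (V ! i)})"
      using len by (auto simp: p list_eq_iff_nth_eq)
    also have "openin ?T \<dots>"
    proof -
      have "{..<length U} \<noteq> {}" using pair_nonempty that p by auto
      then show ?thesis by (intro openin_Int openin_topspace openin_INT2 ev) (rule finite_lessThan)
    qed
    finally show ?thesis unfolding closedin_def by (auto simp: p)
  qed
  have nonempty: "\<Inter>(?C ` E) \<noteq> {}"
  proof -
    have fip: "\<Inter>\<F> \<noteq> {}" if F: "finite \<F>" "\<F> \<subseteq> ?C ` E" for \<F>
    proof -
      obtain E' where E': "E' \<subseteq> E" "finite E'" "\<F> = ?C ` E'"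
        using finite_subset_image[OF F] by blast
      let ?X = "\<Union>(U, V)\<in>E'. set U \<union> set V"
      have "finite ?X" using E' by auto
      from Sep_nonempty[OF this] obtain c where c: "c \<in> Sep ?X" by blast
      let ?\<mu> = "\<lambda>x. if x \<in> ?X then c x else 0"
      have top: "?\<mu> \<in> topspace ?T"
        using c B_pos by (auto simp: separating_def PiE_iff)
      have "?\<mu> \<in> ?C (U, V)" if UV: "(U, V) \<in> E'" for U V
      proof -
        have s: "set U \<union> set V \<subseteq> ?X" using UV by auto
        then have "map ?\<mu> U = map c U" "map ?\<mu> V = map c V" by (auto intro!: map_cong)
        moreover have "map c U \<noteq> map c V" using c s UV E'(1) by (auto simp: separating_def)
        ultimately have "map ?\<mu> U \<noteq> map ?\<mu> V" by metis
        then show ?thesis using top by blast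
      qed
      then show ?thesis unfolding E'(3) by blast
    qed
    show ?thesis
      by (rule comp[unfolded compact_space_fip, THEN spec, THEN mp]) (use closed fip in \<open>auto simp del: Inf_eq_bot_iff\<close>)
  qed
  show ?thesis
  proof (cases "E = {}")
    case True
    then show ?thesis using B_pos by (intro exI[of _ "\<lambda>_. 0"]) simp
  next
    case False
    obtain c where "c \<in> \<Inter>(?C ` E)" using nonempty unfolding ex_in_conv[symmetric] by (elim exE)
    then have c: "c \<in> ?C p" if "p \<in> E" for p using that by (rule INT_D)
    obtain p where "p \<in> E" using False by blast
    then have "c \<in> ?C p" by (rule c)
    then have "c \<in> topspace ?T" by (cases p) simp
    then have "c x < 4 * B" for x by (auto simp: PiE_iff)
    moreover have "map c U \<noteq> map c V" if "(U, V) \<in> E" for U V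
      using c[OF that] by simp
    ultimately show ?thesis by blast
  qed
qed

end

section \<open>Walls in a right-angled Coxeter group\<close>

text \<open>
  The data of a right-angled Coxeter group with a chosen set \<open>C\<close> of commutation relations.
\<close>

locale racg = group G for G :: "('a, 'b) monoid_scheme" (structure) +
  fixes S :: "'a set" and C :: "('a \<times> 'a) set"
  assumes finite_S: "finite S"
    and S_carrier: "S \<subseteq> carrier G"
    and generate_S: "generate G S = carrier G"
    and ord_S: "s \<in> S \<Longrightarrow> ord s = 2"
    and C_S: "C \<subseteq> S \<times> S"
    and C_commute: "(s, t) \<in> C \<Longrightarrow> s \<otimes> t = t \<otimes> s"
    and presentation: "w \<in> lists (S \<times> UNIV) \<Longrightarrow> word_value G w = \<one> \<Longrightarrow> racg_equiv S C w []"
begin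

lemma S_closed [simp, intro]: "s \<in> S \<Longrightarrow> s \<in> carrier G"
  using S_carrier by auto

lemma S_square [simp]: "s \<in> S \<Longrightarrow> s \<otimes> s = \<one>"
  using pow_ord_eq_1[of s] ord_S[of s] by (simp add: numeral_2_eq_2)

lemma S_square_assoc [simp]: "s \<in> S \<Longrightarrow> x \<in> carrier G \<Longrightarrow> s \<otimes> (s \<otimes> x) = x"
  by (simp flip: m_assoc)

lemma S_inv [simp]: "s \<in> S \<Longrightarrow> inv s = s"
  by (rule inv_equality) auto

lemma S_not_one: "s \<in> S \<Longrightarrow> s \<noteq> \<one>"
  using ord_S[of s] by auto

definition value_of :: "'a list \<Rightarrow> 'a" where
  "value_of w = foldr (\<otimes>) w \<one>"

lemma value_of_simps [simp]: "value_of [] = \<one>" "value_of (s # w) = s \<otimes> value_of w"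
  by (simp_all add: value_of_def)

lemma value_of_closed [simp, intro]: "set w \<subseteq> S \<Longrightarrow> value_of w \<in> carrier G"
  by (induction w) auto

lemma value_of_append [simp]:
  "set v \<subseteq> S \<Longrightarrow> set w \<subseteq> S \<Longrightarrow> value_of (v @ w) = value_of v \<otimes> value_of w"
  by (induction v) (auto simp: m_assoc)

lemma value_of_rev: "set w \<subseteq> S \<Longrightarrow> value_of (rev w) = inv (value_of w)"
  by (induction w) (auto simp: inv_mult_group)

lemma exists_word:
  assumes "g \<in> carrier G"
  shows "\<exists>w. set w \<subseteq> S \<and> value_of w = g"
proof -
  have "g \<in> generate G S" using assms generate_S by simp
  then show ?thesis
  proof induction
    case one
    show ?case by (rule exI[of _ "[]"]) simp
  next
    case (incl h)
    then show ?case by (intro exI[of _ "[h]"]) auto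
  next
    case (inv h)
    then show ?case by (intro exI[of _ "[h]"]) auto
  next
    case (eng h1 h2)
    then obtain u v where "set u \<subseteq> S" "value_of u = h1" "set v \<subseteq> S" "value_of v = h2" by blast
    then show ?case by (intro exI[of _ "u @ v"]) auto
  qed
qed

text \<open>
  The reflections in the walls crossed by the path with label \<open>w\<close> that starts at \<open>x\<close>, where only
  letters in \<open>A\<close> are counted. The inverse of the start of each edge undoes the translation, so both
  orientations of an edge give the same reflection.
\<close>

fun walls :: "'a set \<Rightarrow> 'a \<Rightarrow> 'a list \<Rightarrow> 'a list" where
  "walls A x [] = []"
| "walls A x (s # w) = (if s \<in> A then [x \<otimes> s \<otimes> inv x] else []) @ walls A (x \<otimes> s) w"

lemma walls_append:
  "x \<in> carrier G \<Longrightarrow> set u \<subseteq> S \<Longrightarrow> set v \<subseteq> S \<Longrightarrow>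
    walls A x (u @ v) = walls A x u @ walls A (x \<otimes> value_of u) v"
  by (induction u arbitrary: x) (auto simp: m_assoc)

lemma walls_subset:
  assumes "A \<subseteq> B"
  shows "set (walls A x w) \<subseteq> set (walls B x w)" "distinct (walls B x w) \<Longrightarrow> distinct (walls A x w)"
  using assms
proof (induction w arbitrary: x)
  case (Cons s w)
  { case 1
    show ?case using Cons.IH(1)[of "x \<otimes> s"] assms by auto
  next
    case 2
    then show ?case using Cons.IH[of "x \<otimes> s"] assms by (auto split: if_splits)
  }
qed auto

lemma wall_decomposition:
  assumes "x \<in> carrier G" "set w \<subseteq> S" "r \<in> set (walls A x w)"
  shows "\<exists>u s v. w = u @ s # v \<and> s \<in> A \<and> r = x \<otimes> value_of u \<otimes> s \<otimes> inv (x \<otimes> value_of u)"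
  using assms
proof (induction w arbitrary: x)
  case (Cons s w)
  show ?case
  proof (cases "s \<in> A \<and> r = x \<otimes> s \<otimes> inv x")
    case True
    then show ?thesis using Cons.prems by (intro exI[of _ "[]"] exI[of _ s] exI[of _ w]) simp
  next
    case False
    then have "r \<in> set (walls A (x \<otimes> s) w)" using Cons.prems by (auto split: if_splits)
    then obtain u t v where uv: "w = u @ t # v" "t \<in> A" "r = x \<otimes> s \<otimes> value_of u \<otimes> t \<otimes> inv (x \<otimes> s \<otimes> value_of u)"
      using Cons.IH[of "x \<otimes> s"] Cons.prems by auto
    then have "r = x \<otimes> value_of (s # u) \<otimes> t \<otimes> inv (x \<otimes> value_of (s # u))"
      using Cons.prems by (simp add: m_assoc)
    then show ?thesis using uv by (intro exI[of _ "s # u"] exI[of _ t] exI[of _ v]) simp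
  qed
qed simp

lemma reflection_mult:
  assumes "x \<in> carrier G" "s \<in> S" "y \<in> carrier G"
  shows "x \<otimes> s \<otimes> inv x \<otimes> (x \<otimes> (s \<otimes> y)) = x \<otimes> y"
proof -
  have "inv x \<otimes> (x \<otimes> (s \<otimes> y)) = s \<otimes> y" using assms by (simp flip: m_assoc)
  then show ?thesis using assms by (simp add: m_assoc)
qed

lemma walls_rev:
  assumes "x \<in> carrier G" "set w \<subseteq> S"
  shows "set (walls A (x \<otimes> value_of w) (rev w)) = set (walls A x w)"
  using assms
proof (induction w arbitrary: x)
  case (Cons s w)
  have eq: "x \<otimes> value_of (s # w) = x \<otimes> s \<otimes> value_of w" using Cons.prems by (simp add: m_assoc)
  have "x \<otimes> s \<otimes> value_of w \<otimes> value_of (rev w) = x \<otimes> s"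
    using Cons.prems by (simp add: value_of_rev m_assoc)
  then have "set (walls A (x \<otimes> value_of (s # w)) (rev (s # w)))
      = set (walls A (x \<otimes> s \<otimes> value_of w) (rev w)) \<union> set (walls A (x \<otimes> s) [s])"
    unfolding eq using Cons.prems by (simp add: walls_append)
  also have "set (walls A (x \<otimes> s \<otimes> value_of w) (rev w)) = set (walls A (x \<otimes> s) w)"
    using Cons by simp
  also have "x \<otimes> s \<otimes> s \<otimes> inv (x \<otimes> s) = x \<otimes> s \<otimes> inv x"
    using Cons.prems by (simp add: m_assoc inv_mult_group)
  then have "set (walls A (x \<otimes> s) [s]) = set (walls A x [s])" by simp
  finally show ?case by auto
qed simp

lemma walls_translate:
  assumes "x \<in> carrier G" "y \<in> carrier G" "set w \<subseteq> S"
  shows "walls A (y \<otimes> x) w = map (\<lambda>r. y \<otimes> r \<otimes> inv y) (walls A x w)"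
  using assms
proof (induction w arbitrary: x)
  case (Cons s w)
  have "walls A (y \<otimes> (x \<otimes> s)) w = map (\<lambda>r. y \<otimes> r \<otimes> inv y) (walls A (x \<otimes> s) w)"
    using Cons by simp
  then show ?case using Cons.prems by (simp add: m_assoc inv_mult_group)
qed simp

section \<open>Word length and deletion\<close>

definition word_length :: "'a \<Rightarrow> nat" where
  "word_length g = (LEAST k. \<exists>w. set w \<subseteq> S \<and> value_of w = g \<and> length w = k)"

definition reduced :: "'a list \<Rightarrow> bool" where
  "reduced w \<longleftrightarrow> set w \<subseteq> S \<and> word_length (value_of w) = length w"

lemma word_length_le: "set w \<subseteq> S \<Longrightarrow> word_length (value_of w) \<le> length w"
  unfolding word_length_def by (rule Least_le) auto

lemma exists_reduced:
  assumes "g \<in> carrier G"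
  shows "\<exists>w. reduced w \<and> value_of w = g"
proof -
  have "\<exists>k w. set w \<subseteq> S \<and> value_of w = g \<and> length w = k" using exists_word[OF assms] by auto
  from LeastI_ex[OF this] show ?thesis unfolding reduced_def word_length_def[symmetric] by auto
qed

lemma word_length_one [simp]: "word_length \<one> = 0"
  using word_length_le[of "[]"] by simp

lemma word_length_inv [simp]:
  assumes "g \<in> carrier G"
  shows "word_length (inv g) = word_length g"
proof -
  have "word_length (inv h) \<le> word_length h" if h: "h \<in> carrier G" for h
  proof -
    obtain w where w: "reduced w" "value_of w = h" using exists_reduced[OF h] by blast
    then have "inv h = value_of (rev w)" "set (rev w) \<subseteq> S" by (auto simp: reduced_def value_of_rev)
    then show ?thesis using word_length_le[of "rev w"] w by (auto simp: reduced_def)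
  qed
  from this[of g] this[of "inv g"] show ?thesis using assms by simp
qed

lemma word_length_mult_le:
  assumes "g \<in> carrier G" "h \<in> carrier G"
  shows "word_length (g \<otimes> h) \<le> word_length g + word_length h"
proof -
  obtain u where "reduced u" "value_of u = g" using exists_reduced[OF assms(1)] by blast
  moreover obtain v where "reduced v" "value_of v = h" using exists_reduced[OF assms(2)] by blast
  ultimately show ?thesis using word_length_le[of "u @ v"] by (auto simp: reduced_def)
qed

lemma reduced_append:
  assumes "reduced (u @ v)"
  shows "reduced u" "reduced v"
proof -
  have S: "set u \<subseteq> S" "set v \<subseteq> S" using assms by (auto simp: reduced_def)
  have "length u + length v \<le> word_length (value_of u) + word_length (value_of v)"
    using assms S word_length_mult_le[of "value_of u" "value_of v"] by (simp add: reduced_def)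
  then show "reduced u" "reduced v" using S word_length_le[of u] word_length_le[of v] by (auto simp: reduced_def)
qed

text \<open>
  Reflecting the end of a path in a wall that it crosses gives the end of the path without the
  crossing letter.
\<close>

lemma wall_exchange:
  assumes "x \<in> carrier G" "set w \<subseteq> S" "r \<in> set (walls A x w)"
  shows "\<exists>u s v. w = u @ s # v \<and> s \<in> A \<and> r = x \<otimes> value_of u \<otimes> s \<otimes> inv (x \<otimes> value_of u)
    \<and> r \<otimes> (x \<otimes> value_of w) = x \<otimes> value_of (u @ v)"
proof -
  obtain u s v where w: "w = u @ s # v" "s \<in> A" and r: "r = x \<otimes> value_of u \<otimes> s \<otimes> inv (x \<otimes> value_of u)"
    using wall_decomposition[OF assms] by blast
  have S: "set u \<subseteq> S" "s \<in> S" "set v \<subseteq> S" using w assms by auto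
  have "r \<otimes> (x \<otimes> value_of w) = r \<otimes> (x \<otimes> value_of u \<otimes> (s \<otimes> value_of v))"
    using S assms by (simp add: w m_assoc)
  also have "\<dots> = x \<otimes> value_of u \<otimes> value_of v"
    unfolding r using S assms by (intro reflection_mult) auto
  finally show ?thesis using w r S assms by (intro exI[of _ u] exI[of _ s] exI[of _ v]) (simp add: m_assoc)
qed

text \<open>
  The deletion property: if a wall is crossed twice, then reflecting the part in between shortens the
  word by two letters.
\<close>

lemma reduced_walls_distinct:
  assumes "reduced w" "x \<in> carrier G"
  shows "distinct (walls S x w)"
  using assms
proof (induction w arbitrary: x)
  case (Cons s w)
  have S: "s \<in> S" "set w \<subseteq> S" using Cons.prems by (auto simp: reduced_def)
  have red: "reduced w" using reduced_append(2)[of "[s]" w] Cons.prems by simp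
  let ?r = "x \<otimes> s \<otimes> inv x"
  have "?r \<notin> set (walls S (x \<otimes> s) w)"
  proof
    assume "?r \<in> set (walls S (x \<otimes> s) w)"
    then obtain u t v where uv: "w = u @ t # v"
      and "?r \<otimes> (x \<otimes> s \<otimes> value_of w) = x \<otimes> s \<otimes> value_of (u @ v)"
      using wall_exchange[of "x \<otimes> s" w ?r S] S Cons.prems by auto
    moreover have "?r \<otimes> (x \<otimes> s \<otimes> value_of w) = x \<otimes> value_of w"
      using reflection_mult[of x s "value_of w"] S Cons.prems by (simp add: m_assoc)
    ultimately have "x \<otimes> value_of w = x \<otimes> (s \<otimes> value_of (u @ v))"
      using S Cons.prems uv by (auto simp: m_assoc)
    then have "value_of w = s \<otimes> value_of (u @ v)" using S uv Cons.prems by (subst (asm) Units_l_cancel) (auto simp: Units_eq)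
    then have "value_of (s # w) = value_of (u @ v)" using S uv by auto
    then have "word_length (value_of (s # w)) \<le> length (u @ v)" using word_length_le[of "u @ v"] S uv by auto
    then show False using Cons.prems uv by (auto simp: reduced_def)
  qed
  then show ?case using Cons.IH[OF red, of "x \<otimes> s"] Cons.prems S by simp
qed simp

section \<open>The tree of a colour class\<close>

text \<open>
  In such a set, in particular in a colour class, different generators never commute. This is what
  the invariance of the addresses under the commutation relations needs.
\<close>

definition independent :: "'a set \<Rightarrow> bool" where
  "independent A \<longleftrightarrow> (\<forall>s\<in>S \<inter> A. \<forall>t\<in>S \<inter> A. s \<otimes> t = t \<otimes> s \<longrightarrow> s = t)"

text \<open>
  Letters outside \<open>S\<close> may occur in the words related by \<open>racg_equiv\<close>; they are ignored. Signs are
  dropped because generators are involutions.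
\<close>

definition plain :: "('a \<times> bool) list \<Rightarrow> 'a list" where
  "plain w = filter (\<lambda>s. s \<in> S) (map fst w)"

lemma set_plain: "set (plain w) \<subseteq> S"
  by (auto simp: plain_def)

lemma plain_append: "plain (v @ w) = plain v @ plain w"
  by (simp add: plain_def)

text \<open>
  The path in the tree depends on the group element only. Cancelling \<open>ss\<close> removes a wall that is
  crossed back and forth. In a relation \<open>st = ts\<close> with \<open>s \<noteq> t\<close>, at most one letter lies in \<open>A\<close>, and its wall is the
  same on both sides since \<open>s\<close> and \<open>t\<close> commute.
\<close>

lemma racg_equiv_invariant:
  assumes "racg_equiv S C v w" "independent A"
  shows "x \<in> carrier G \<Longrightarrow> distinct_adj L \<Longrightarrow>
    value_of (plain v) = value_of (plain w) \<and>
    fold toggle (walls A x (plain v)) L = fold toggle (walls A x (plain w)) L"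
  using assms(1)
proof (induction arbitrary: x L)
  case (cancel s b)
  have "x \<otimes> s \<otimes> s \<otimes> inv (x \<otimes> s) = x \<otimes> s \<otimes> inv x"
    using cancel by (simp add: m_assoc inv_mult_group)
  then show ?case using cancel by (simp add: plain_def toggle_toggle)
next
  case (involution s)
  have "x \<otimes> s \<otimes> s \<otimes> inv (x \<otimes> s) = x \<otimes> s \<otimes> inv x"
    using involution by (simp add: m_assoc inv_mult_group)
  then show ?case using involution by (simp add: plain_def toggle_toggle)
next
  case (commute s t)
  have st: "s \<in> S" "t \<in> S" and st': "s \<otimes> t = t \<otimes> s" using commute C_S C_commute by auto
  have conj: "x \<otimes> a \<otimes> b \<otimes> inv (x \<otimes> a) = x \<otimes> b \<otimes> inv x" if "a \<in> S" "b \<in> S" "a \<otimes> b = b \<otimes> a" for a b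
  proof -
    have "x \<otimes> a \<otimes> b \<otimes> inv (x \<otimes> a) = x \<otimes> (a \<otimes> b) \<otimes> (a \<otimes> inv x)"
      using that commute by (simp add: m_assoc inv_mult_group)
    also have "\<dots> = x \<otimes> (b \<otimes> a) \<otimes> (a \<otimes> inv x)" using that by simp
    also have "\<dots> = x \<otimes> b \<otimes> inv x" using that commute by (simp add: m_assoc)
    finally show ?thesis .
  qed
  have "s = t" if "s \<in> A" "t \<in> A" using that st st' assms(2) by (auto simp: independent_def)
  then show ?case
    using st st' conj[OF st st'] conj[OF st(2,1) st'[symmetric]] by (auto simp: plain_def)
next
  case (trans u v w)
  then show ?case by metis
next
  case (congruence v w y z)
  let ?x = "x \<otimes> value_of (plain y)" and ?L = "fold toggle (walls A x (plain y)) L"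
  have "?x \<in> carrier G" "distinct_adj ?L"
    using congruence set_plain by (auto simp: distinct_adj_fold_toggle)
  from congruence.IH[OF this] show ?case
    using congruence.prems by (simp add: plain_append walls_append set_plain)
qed auto

definition signed :: "'a list \<Rightarrow> ('a \<times> bool) list" where
  "signed w = map (\<lambda>s. (s, True)) w"

lemma plain_signed: "set w \<subseteq> S \<Longrightarrow> plain (signed w) = w"
  by (simp add: plain_def signed_def comp_def) (induction w; auto)

lemma word_value_signed: "word_value G (signed w) = value_of w"
  by (induction w) (auto simp: word_value_def signed_def letter_value_def)

text \<open>
  The presentation is given by the words with trivial value. Two words \<open>v\<close> and \<open>w\<close> of equal value are
  both equivalent to \<open>v\<close> followed by the reverse of \<open>w\<close> and by \<open>w\<close>.
\<close>

lemma value_of_eq_imp_racg_equiv: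
  assumes "set v \<subseteq> S" "set w \<subseteq> S" "value_of v = value_of w"
  shows "racg_equiv S C (signed v) (signed w)"
proof -
  have trivial: "racg_equiv S C (signed (a @ rev b)) []"
    if "set a \<subseteq> S" "set b \<subseteq> S" "value_of a = value_of b" for a b
  proof (rule presentation)
    show "signed (a @ rev b) \<in> lists (S \<times> UNIV)" using that by (auto simp: signed_def)
    show "word_value G (signed (a @ rev b)) = \<one>"
      using that by (simp add: word_value_signed value_of_rev)
  qed
  have "racg_equiv S C (signed v @ signed (rev w @ w) @ []) (signed v @ [] @ [])"
    using trivial[of "rev w" "rev w"] assms by (intro racg_equiv.congruence) simp
  moreover have "racg_equiv S C ([] @ signed (v @ rev w) @ signed w) ([] @ [] @ signed w)"
    using trivial[OF assms] by (rule racg_equiv.congruence)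
  ultimately show ?thesis
    by (simp add: signed_def) (metis racg_equiv.sym racg_equiv.trans)
qed

text \<open>
  The position of \<open>g\<close> in the tree whose vertices are the components of the complement of the walls of
  type \<open>A\<close>: the list of walls between the identity and \<open>g\<close>, in the order in which they are crossed.
\<close>

definition address :: "'a set \<Rightarrow> 'a \<Rightarrow> 'a list" where
  "address A g = fold toggle (walls A \<one> (SOME w. set w \<subseteq> S \<and> value_of w = g)) []"

lemma address_value_of:
  assumes "independent A" "set w \<subseteq> S"
  shows "address A (value_of w) = fold toggle (walls A \<one> w) []"
proof -
  let ?v = "SOME v. set v \<subseteq> S \<and> value_of v = value_of w"
  have v: "set ?v \<subseteq> S \<and> value_of ?v = value_of w" by (rule someI[of _ w]) (use assms in simp)
  have "racg_equiv S C (signed ?v) (signed w)"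
    using v assms by (intro value_of_eq_imp_racg_equiv) auto
  from racg_equiv_invariant[OF this assms(1) one_closed, of "[]"] show ?thesis
    using v assms by (simp add: address_def plain_signed)
qed

lemma address_one [simp]: "independent A \<Longrightarrow> address A \<one> = []"
  using address_value_of[of A "[]"] by simp

lemma address_mult:
  assumes "independent A" "g \<in> carrier G" "set w \<subseteq> S"
  shows "address A (g \<otimes> value_of w) = fold toggle (walls A g w) (address A g)"
proof -
  obtain u where u: "set u \<subseteq> S" "value_of u = g" using exists_word assms by blast
  have "address A (value_of (u @ w)) = fold toggle (walls A \<one> (u @ w)) []"
    using u assms by (intro address_value_of) auto
  then show ?thesis using u assms address_value_of[OF assms(1) u(1)] by (simp add: walls_append)
qed

lemma inv_cancel_left:
  "x \<in> carrier G \<Longrightarrow> y \<in> carrier G \<Longrightarrow> inv x \<otimes> (x \<otimes> y) = y"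
  by (simp flip: m_assoc)

lemma length_walls: "length (walls A x w) = length (filter (\<lambda>s. s \<in> A) w)"
  by (induction w arbitrary: x) auto

text \<open>
  A reduced word crosses every wall once, so its path in the tree is a geodesic.
\<close>

lemma address_along_geodesic:
  assumes A: "independent A" "A \<subseteq> S" and g: "g \<in> carrier G" and w: "reduced w"
  defines "u \<equiv> address A g" and "v \<equiv> address A (g \<otimes> value_of w)"
  shows "distinct (branch u v @ branch v u)"
    and "set (branch u v @ branch v u) = set (walls A g w)"
    and "tree_dist u v = length (filter (\<lambda>s. s \<in> A) w)"
proof -
  have word_dist: "distinct (walls A g w)"
    using reduced_walls_distinct[OF w g] walls_subset(2)[OF A(2)] by blast
  have v: "v = fold toggle (walls A g w) u"
    unfolding u_def v_def using w by (intro address_mult A(1) g) (simp add: reduced_def)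
  obtain P Q R where PQR: "u = P @ Q" "v = P @ R" "distinct (Q @ R)" "set (Q @ R) = set (walls A g w)"
    using fold_toggle_distinct[OF word_dist, of u] unfolding v by blast
  have br: "branch u v = Q" "branch v u = R"
    unfolding PQR(1,2) using PQR(3) by (intro branch_disjoint; auto)+
  show "distinct (branch u v @ branch v u)" "set (branch u v @ branch v u) = set (walls A g w)"
    unfolding br by (fact PQR)+
  have "length (Q @ R) = length (walls A g w)"
    using PQR(3,4) word_dist by (metis distinct_card)
  then show "tree_dist u v = length (filter (\<lambda>s. s \<in> A) w)"
    by (simp add: tree_dist_def br length_walls)
qed

lemma distinct_branches:
  assumes "independent A" "A \<subseteq> S" "g \<in> carrier G" "h \<in> carrier G"
  shows "distinct (branch (address A g) (address A h) @ branch (address A h) (address A g))"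
proof -
  obtain w where w: "reduced w" "value_of w = inv g \<otimes> h"
    using exists_reduced[of "inv g \<otimes> h"] assms by auto
  then have "g \<otimes> value_of w = h" using assms by (simp flip: m_assoc)
  then show ?thesis using address_along_geodesic(1)[OF assms(1-3) w(1)] by simp
qed

lemma address_reduced:
  assumes "independent A" "A \<subseteq> S" "reduced w"
  shows "set (address A (value_of w)) = set (walls A \<one> w)" "distinct (address A (value_of w))"
proof -
  have b: "branch (address A \<one>) v = []" "branch v (address A \<one>) = v" for v :: "'a list"
    using assms(1) by (cases v; simp)+
  have "value_of w \<in> carrier G" using assms(3) by (auto simp: reduced_def)
  then show "set (address A (value_of w)) = set (walls A \<one> w)" "distinct (address A (value_of w))"
    using address_along_geodesic(1,2)[OF assms(1,2) one_closed assms(3)] by (auto simp: b)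
qed

lemma distinct_address:
  assumes "independent A" "A \<subseteq> S" "g \<in> carrier G"
  shows "distinct (address A g)"
proof -
  obtain w where "reduced w" "value_of w = g" using exists_reduced[OF assms(3)] by blast
  then show ?thesis using address_reduced(2)[OF assms(1,2)] by blast
qed

section \<open>The middle of a reflection\<close>

text \<open>
  A wall on the way to some element separates the identity from its own reflection \<open>r\<close>. With
  \<open>r = u s u\<^sup>-\<^sup>1\<close>, where the word \<open>u s\<close> is reduced, the path \<open>u s u\<^sup>-\<^sup>1\<close> crosses the wall with the letter \<open>s\<close> and not
  again: its second half is the mirror image of the path \<open>u\<close>, which does not cross the wall.
\<close>

lemma mem_own_address:
  assumes A: "independent A" "A \<subseteq> S" and g: "g \<in> carrier G" and r: "r \<in> set (address A g)"
  shows "r \<in> carrier G" "r \<otimes> r = \<one>" "r \<in> set (address A r)"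
proof -
  obtain w where w: "reduced w" "value_of w = g" using exists_reduced[OF g] by blast
  then have wS: "set w \<subseteq> S" by (simp add: reduced_def)
  have "r \<in> set (walls A \<one> w)" using address_reduced(1)[OF A w(1)] r w(2) by simp
  from wall_decomposition[OF one_closed wS this] obtain u s v where
    uv: "w = u @ s # v" "s \<in> A" "r = \<one> \<otimes> value_of u \<otimes> s \<otimes> inv (\<one> \<otimes> value_of u)" by blast
  have S: "set u \<subseteq> S" "s \<in> S" using uv wS by auto
  have rr: "r = value_of u \<otimes> s \<otimes> inv (value_of u)" using uv S by simp
  show rc: "r \<in> carrier G" using rr S by auto
  have ru: "r \<otimes> value_of u = value_of u \<otimes> s" using S by (simp add: rr m_assoc)
  have "r \<otimes> r = r \<otimes> value_of u \<otimes> (s \<otimes> inv (value_of u))" using S rc by (subst (2) rr) (simp add: m_assoc)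
  also have "\<dots> = \<one>" unfolding ru using S by (simp add: m_assoc)
  finally show "r \<otimes> r = \<one>" .
  have red: "reduced (u @ [s])" using reduced_append(1)[of "u @ [s]" v] w uv by simp
  have "walls A \<one> (u @ [s]) = walls A \<one> u @ [r]" using S uv(2) rr by (simp add: walls_append)
  then have d: "r \<notin> set (walls A \<one> u)" "r \<in> set (address A (value_of (u @ [s])))"
    using reduced_walls_distinct[OF red one_closed] walls_subset(2)[OF A(2)] address_reduced(1)[OF A red]
    by fastforce+
  have "set (walls A (r \<otimes> value_of u) (rev u)) = set (walls A (r \<otimes> \<one>) u)"
    using walls_rev[OF rc S(1)] rc by simp
  also have "\<dots> = (\<lambda>q. r \<otimes> q \<otimes> inv r) ` set (walls A \<one> u)"
    using walls_translate[OF one_closed rc S(1)] by simp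
  finally have returning: "set (walls A (r \<otimes> value_of u) (rev u)) = (\<lambda>q. r \<otimes> q \<otimes> inv r) ` set (walls A \<one> u)" .
  have "r \<notin> set (walls A (r \<otimes> value_of u) (rev u))"
  proof
    assume "r \<in> set (walls A (r \<otimes> value_of u) (rev u))"
    then obtain q where q: "q \<in> set (walls A \<one> u)" "r = r \<otimes> q \<otimes> inv r" unfolding returning by blast
    have "q \<in> carrier G" using wall_decomposition[OF one_closed S(1) q(1)] A(2) S by auto
    then have "r \<otimes> q = r \<otimes> r" using q(2) rc by (metis inv_solve_right m_closed)
    then have "q = r" using rc \<open>q \<in> carrier G\<close> Units_l_cancel by (simp add: Units_eq)
    then show False using q d by simp
  qed
  then have "r \<in> set (address A (value_of (u @ [s]) \<otimes> value_of (rev u)))"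
    using d(2) S ru by (subst address_mult[OF A(1)]) (auto simp: mem_fold_toggle)
  also have "value_of (u @ [s]) \<otimes> value_of (rev u) = r" using S by (simp add: rr value_of_rev)
  finally show "r \<in> set (address A r)" .
qed

definition word_dist :: "'a \<Rightarrow> 'a \<Rightarrow> nat" where
  "word_dist g h = word_length (inv g \<otimes> h)"

text \<open>
  A reduced word of the reflection \<open>r\<close> crosses the wall of \<open>r\<close>. By exchange, deleting the crossing
  letter leaves a word of value \<open>r r = 1\<close>, so the parts before and behind it are inverse to each other
  and have equal length. The element \<open>b\<close> is reached right behind the wall.
\<close>

lemma wall_midpoint:
  assumes A: "independent A" "A \<subseteq> S" and g: "g \<in> carrier G" and r: "r \<in> set (address A g)"
  shows "\<exists>b\<in>carrier G. r \<in> set (address A b) \<and> word_length r + 1 = 2 * word_length b \<and> word_dist b r + 1 = word_length b"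
proof -
  note r = mem_own_address[OF A g r]
  obtain w where w: "reduced w" "value_of w = r" using exists_reduced[OF r(1)] by blast
  then have wS: "set w \<subseteq> S" by (simp add: reduced_def)
  have "r \<in> set (walls A \<one> w)" using address_reduced(1)[OF A w(1)] r w(2) by simp
  from wall_exchange[OF one_closed wS this] obtain u s v where
    uv: "w = u @ s # v" "s \<in> A" "r = \<one> \<otimes> value_of u \<otimes> s \<otimes> inv (\<one> \<otimes> value_of u)"
      "r \<otimes> (\<one> \<otimes> value_of w) = \<one> \<otimes> value_of (u @ v)" by blast
  have S: "set u \<subseteq> S" "s \<in> S" "set v \<subseteq> S" using uv wS by auto
  have red: "reduced (u @ [s])" "reduced u" "reduced v"
    using reduced_append[of "u @ [s]" v] reduced_append(1)[of u "[s]"] w uv by auto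
  have "value_of u \<otimes> value_of v = \<one>" using uv(4) r w S by simp
  then have "value_of v = inv (value_of u)" using S by (metis inv_equality inv_inv value_of_closed)
  then have uv_len: "length v = length u" using red S by (auto simp: reduced_def)
  let ?b = "value_of (u @ [s])"
  have rb: "r = ?b \<otimes> value_of v" using w uv(1) S by (auto simp: m_assoc)
  have "inv ?b \<otimes> r = value_of v" unfolding rb by (rule inv_cancel_left) (use S in auto)
  then have "word_dist ?b r = length u" using red(3) uv_len by (simp add: word_dist_def reduced_def)
  moreover have "word_length ?b = length u + 1" using red(1) by (simp add: reduced_def del: value_of_append)
  moreover have "word_length r = 2 * length u + 1" using w uv(1) uv_len by (auto simp: reduced_def)
  moreover have "r \<in> set (address A ?b)"
    using address_reduced(1)[OF A red(1)] uv(2,3) S by (simp add: walls_append)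
  ultimately show ?thesis using S by (intro bexI[of _ ?b]) auto
qed

text \<open>
  Exchange, applied to a reduced word of \<open>g\<close>; reflections are involutions.
\<close>

lemma reflection_shortens:
  assumes A: "independent A" "A \<subseteq> S" and g: "g \<in> carrier G" and r: "r \<in> set (address A g)"
  shows "word_dist r g < word_length g"
proof -
  obtain w where w: "reduced w" "value_of w = g" using exists_reduced[OF g] by blast
  then have wS: "set w \<subseteq> S" by (simp add: reduced_def)
  have "r \<in> set (walls A \<one> w)" using address_reduced(1)[OF A w(1)] r w(2) by simp
  from wall_exchange[OF one_closed wS this] obtain u s v where
    uv: "w = u @ s # v" "r \<otimes> (\<one> \<otimes> value_of w) = \<one> \<otimes> value_of (u @ v)" by blast
  have "inv r = r" using mem_own_address[OF A g r] by (simp add: inv_equality)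
  then have "word_dist r g = word_length (value_of (u @ v))" using uv w g wS by (simp add: word_dist_def)
  also have "\<dots> \<le> length (u @ v)" using uv wS by (intro word_length_le) auto
  finally show ?thesis using w uv by (auto simp: reduced_def)
qed

lemma word_dist_commute: "g \<in> carrier G \<Longrightarrow> h \<in> carrier G \<Longrightarrow> word_dist g h = word_dist h g"
  unfolding word_dist_def using word_length_inv[of "inv g \<otimes> h"] by (simp add: inv_mult_group)

lemma word_dist_one [simp]: "g \<in> carrier G \<Longrightarrow> word_dist \<one> g = word_length g"
  by (simp add: word_dist_def)

lemma ball_subset:
  assumes "g \<in> carrier G"
  shows "{h \<in> carrier G. word_dist g h \<le> m} \<subseteq>
    (\<lambda>w. g \<otimes> foldr (\<otimes>) w \<one>) ` {w. set w \<subseteq> insert \<one> S \<and> length w = m}"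
proof
  fix h assume "h \<in> {h \<in> carrier G. word_dist g h \<le> m}"
  then have h: "h \<in> carrier G" "word_dist g h \<le> m" by auto
  obtain w where w: "reduced w" "value_of w = inv g \<otimes> h"
    using exists_reduced[of "inv g \<otimes> h"] assms h by auto
  let ?w = "replicate (m - length w) \<one> @ w"
  have "foldr (\<otimes>) (replicate k \<one>) x = x" if "x \<in> carrier G" for k x
    using that by (induction k) auto
  then have "foldr (\<otimes>) ?w \<one> = value_of w"
    using w assms h by (simp add: value_of_def)
  then have "h = g \<otimes> foldr (\<otimes>) ?w \<one>" using w assms h by (simp flip: m_assoc)
  moreover have "set ?w \<subseteq> insert \<one> S" "length ?w = m"
    using w h by (auto simp: reduced_def word_dist_def)
  ultimately show "h \<in> (\<lambda>w. g \<otimes> foldr (\<otimes>) w \<one>) ` {w. set w \<subseteq> insert \<one> S \<and> length w = m}"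
    by (intro image_eqI[of _ _ ?w] CollectI conjI)
qed

lemma ball_card:
  assumes "g \<in> carrier G"
  shows "finite {h \<in> carrier G. word_dist g h \<le> m}" "card {h \<in> carrier G. word_dist g h \<le> m} \<le> (card S + 1) ^ m"
proof -
  have fin: "finite {w. set w \<subseteq> insert \<one> S \<and> length w = m}"
    using finite_S by (intro finite_lists_length_eq) simp
  show "finite {h \<in> carrier G. word_dist g h \<le> m}"
    using finite_subset[OF ball_subset[OF assms]] fin by blast
  have "card {h \<in> carrier G. word_dist g h \<le> m} \<le> card {w. set w \<subseteq> insert \<one> S \<and> length w = m}"
    by (rule surj_card_le[OF fin ball_subset[OF assms]])
  also have "\<dots> = card (insert \<one> S) ^ m" using finite_S by (intro card_lists_length_eq) simp
  also have "\<dots> \<le> (card S + 1) ^ m" using S_not_one finite_S by (intro power_mono) (auto simp: card_insert_if)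
  finally show "card {h \<in> carrier G. word_dist g h \<le> m} \<le> (card S + 1) ^ m" .
qed

end

section \<open>The isometric embedding into a product of trees\<close>

locale coloured_racg = racg +
  fixes col :: "'a \<Rightarrow> nat" and n :: nat
  assumes col_less: "s \<in> S \<Longrightarrow> col s < n"
    and col_commute: "s \<in> S \<Longrightarrow> t \<in> S \<Longrightarrow> s \<otimes> t = t \<otimes> s \<Longrightarrow> s \<noteq> t \<Longrightarrow> col s \<noteq> col t"
begin

definition colour_class :: "nat \<Rightarrow> 'a set" where
  "colour_class c = {s \<in> S. col s = c}"

lemma colour_class: "independent (colour_class c)" "colour_class c \<subseteq> S"
  using col_commute unfolding colour_class_def independent_def by blast+

abbreviation addr :: "nat \<Rightarrow> 'a \<Rightarrow> 'a list" where
  "addr c \<equiv> address (colour_class c)"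

lemma sum_colour_classes:
  "set w \<subseteq> S \<Longrightarrow> (\<Sum>c<n. length (filter (\<lambda>s. s \<in> colour_class c) w)) = length w"
proof (induction w)
  case (Cons s w)
  have "length (filter (\<lambda>s. s \<in> colour_class c) (s # w))
      = (if c = col s then 1 else 0) + length (filter (\<lambda>s. s \<in> colour_class c) w)" for c
    using Cons.prems by (auto simp: colour_class_def)
  then have "(\<Sum>c<n. length (filter (\<lambda>s. s \<in> colour_class c) (s # w)))
      = (\<Sum>c<n. (if c = col s then 1 else 0)) + length w"
    using Cons by (simp only: sum.distrib) simp
  also have "(\<Sum>c<n. (if c = col s then 1 else 0 :: nat)) = 1"
    using Cons.prems col_less by simp
  finally show ?case by simp
qed simp

text \<open>
  Every letter of a reduced word moves by one edge in the tree of its colour, and none of these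
  paths backtracks.
\<close>

theorem word_dist_eq_sum_tree_dist:
  assumes "g \<in> carrier G" "h \<in> carrier G"
  shows "word_dist g h = (\<Sum>c<n. tree_dist (addr c g) (addr c h))"
proof -
  obtain w where w: "reduced w" "value_of w = inv g \<otimes> h"
    using exists_reduced[of "inv g \<otimes> h"] assms by auto
  then have h: "g \<otimes> value_of w = h" using assms by (simp flip: m_assoc)
  have "(\<Sum>c<n. tree_dist (addr c g) (addr c h)) = (\<Sum>c<n. length (filter (\<lambda>s. s \<in> colour_class c) w))"
    using address_along_geodesic(3)[OF colour_class assms(1) w(1)] h by simp
  also have "\<dots> = length w" using w(1) by (intro sum_colour_classes) (simp add: reduced_def)
  finally show ?thesis using w by (simp add: word_dist_def reduced_def)
qed

lemma word_length_eq_sum_length: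
  assumes "g \<in> carrier G"
  shows "word_length g = (\<Sum>c<n. length (addr c g))"
  using word_dist_eq_sum_tree_dist[of \<one> g] assms by (simp add: colour_class)

section \<open>Hyperbolicity and the labelling of walls\<close>

lemma word_length_triangle: "h \<in> carrier G \<Longrightarrow> g \<in> carrier G \<Longrightarrow> word_length g \<le> word_length h + word_dist h g"
  using word_length_mult_le[of h "inv h \<otimes> g"] by (simp add: word_dist_def flip: m_assoc)

text \<open>
  Gromov products in the word metric, based at the identity.
\<close>

definition gromov_prod :: "'a \<Rightarrow> 'a \<Rightarrow> real" where
  "gromov_prod g h = (real (word_length g) + real (word_length h) - real (word_dist g h)) / 2"

definition word_hyperbolic :: "real \<Rightarrow> bool" where
  "word_hyperbolic \<delta> \<longleftrightarrow> (\<forall>x\<in>carrier G. \<forall>y\<in>carrier G. \<forall>z\<in>carrier G.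
     gromov_prod x z \<ge> min (gromov_prod x y) (gromov_prod y z) - \<delta>)"

definition midpoint :: "nat \<Rightarrow> 'a \<Rightarrow> 'a" where
  "midpoint c r = (SOME b. b \<in> carrier G \<and> r \<in> set (addr c b) \<and> word_length r + 1 = 2 * word_length b \<and> word_dist b r + 1 = word_length b)"

lemma midpoint:
  assumes "g \<in> carrier G" "r \<in> set (addr c g)"
  shows "midpoint c r \<in> carrier G" "r \<in> set (addr c (midpoint c r))"
    "word_length r + 1 = 2 * word_length (midpoint c r)" "word_dist (midpoint c r) r + 1 = word_length (midpoint c r)"
proof -
  have "\<exists>b. b \<in> carrier G \<and> r \<in> set (addr c b) \<and> word_length r + 1 = 2 * word_length b \<and> word_dist b r + 1 = word_length b"
    using wall_midpoint[OF colour_class assms] by blast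
  from someI_ex[OF this] show "midpoint c r \<in> carrier G" "r \<in> set (addr c (midpoint c r))"
    "word_length r + 1 = 2 * word_length (midpoint c r)" "word_dist (midpoint c r) r + 1 = word_length (midpoint c r)"
    unfolding midpoint_def by blast+
qed

text \<open>
  The Gromov product counts the walls, of all colours, that separate the identity from both \<open>x\<close> and
  \<open>h\<close>. The walls in \<open>Q\<close> separate it from \<open>x\<close> only.
\<close>

lemma gromov_prod_missing_walls:
  assumes x: "x \<in> carrier G" and h: "h \<in> carrier G" and c: "c < n"
    and P: "addr c x = P @ Q" "addr c h = P @ R" and Q: "Q = [] \<or> R = [] \<or> hd Q \<noteq> hd R"
  shows "gromov_prod x h \<le> real (word_length x) - real (length Q)"
proof -
  have t: "tree_dist (addr c x) (addr c h) = length Q + length R"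
    unfolding P tree_dist_append using Q branch_heads_differ[of Q R] branch_heads_differ[of R Q]
    by (auto simp: tree_dist_def)
  have "word_length h + 2 * length Q = (\<Sum>c'<n. length (addr c' h) + (if c' = c then 2 * length Q else 0))"
    using c by (simp add: word_length_eq_sum_length[OF h] sum.distrib)
  also have "\<dots> \<le> (\<Sum>c'<n. length (addr c' x) + tree_dist (addr c' x) (addr c' h))"
  proof (rule sum_mono)
    fix c' show "length (addr c' h) + (if c' = c then 2 * length Q else 0)
        \<le> length (addr c' x) + tree_dist (addr c' x) (addr c' h)"
      using tree_dist_ge[of "addr c' h" "addr c' x"] t P by auto
  qed
  also have "\<dots> = word_length x + word_dist x h"
    by (simp add: word_length_eq_sum_length[OF x] word_dist_eq_sum_tree_dist[OF x h] sum.distrib)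
  finally show ?thesis by (simp add: gromov_prod_def)
qed

text \<open>
  The place where hyperbolicity bounds how often a wall is met. Let \<open>r\<close> be the wall of index \<open>i\<close> behind
  the branching of the addresses of \<open>g\<close> and \<open>h\<close>, and \<open>b\<close> its midpoint. By the choice of \<open>b\<close>, its Gromov
  product with \<open>r\<close> is \<open>|b|\<close>, and that of \<open>r\<close> with \<open>g\<close> is at least \<open>|r| / 2\<close>, so that of \<open>b\<close> with \<open>g\<close> is
  nearly \<open>|b|\<close>. In the tree of the colour \<open>c\<close>, the walls before \<open>r\<close> also lie on the way to \<open>b\<close>; hence \<open>i + 1\<close> walls separate
  \<open>b\<close> but not \<open>h\<close> from the identity, and the Gromov product of \<open>b\<close> with \<open>h\<close> is at most \<open>|b| - (i + 1)\<close>.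
  If \<open>i\<close> exceeds \<open>2 \<delta>\<close>, the hyperbolic inequality for \<open>b\<close>, \<open>g\<close>, \<open>h\<close> leaves only one possibility: the Gromov
  product of \<open>g\<close> and \<open>h\<close> is at most \<open>|b|\<close>, so \<open>b\<close> lies behind the branching point.
\<close>

lemma midpoint_near:
  assumes hyp: "word_hyperbolic \<delta>" and g: "g \<in> carrier G" and h: "h \<in> carrier G" and c: "c < n"
    and i: "i < length (branch (addr c g) (addr c h))" "2 * \<delta> < real i"
  defines "b \<equiv> midpoint c (branch (addr c g) (addr c h) ! i)"
  shows "b \<in> carrier G" "real (word_dist b g) \<le> real (word_dist g h) + 1 + 2 * \<delta>"
proof -
  let ?Q = "branch (addr c g) (addr c h)" and ?R = "branch (addr c h) (addr c g)"
  obtain P where P: "addr c g = P @ ?Q" "addr c h = P @ ?R" using branch_common_prefix by blast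
  define r where "r = ?Q ! i"
  have rQ: "r \<in> set ?Q" using i unfolding r_def by simp
  then have rg: "r \<in> set (addr c g)" by (subst P) simp
  note m = midpoint[OF g rg, folded b_def[folded r_def]]
  have rc: "r \<in> carrier G" using mem_own_address(1)[OF colour_class g rg] .
  show b: "b \<in> carrier G" using m by blast
  have "gromov_prod b r = word_length b" using m by (simp add: gromov_prod_def)
  moreover have "gromov_prod r g \<ge> real (word_length b) - 1/2"
    using reflection_shortens[OF colour_class g rg] m(3) by (simp add: gromov_prod_def)
  moreover have "gromov_prod b g \<ge> min (gromov_prod b r) (gromov_prod r g) - \<delta>"
    using hyp b rc g by (simp add: word_hyperbolic_def)
  ultimately have bg: "gromov_prod b g \<ge> real (word_length b) - 1/2 - \<delta>" by linarith
  have bh_le: "gromov_prod b h \<le> real (word_length b) - real (i + 1)"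
  proof -
    let ?Q' = "branch (addr c b) (addr c g)" and ?R' = "branch (addr c g) (addr c b)"
    obtain P' where P': "addr c b = P' @ ?Q'" "addr c g = P' @ ?R'" using branch_common_prefix by blast
    have "r \<notin> set ?R'"
    proof
      assume R': "r \<in> set ?R'"
      then have "r \<notin> set ?Q'" using distinct_branches[OF colour_class b g] by auto
      then have "r \<in> set P'" using m(2) P'(1) by (metis UnE set_append)
      then show False using R' distinct_address[OF colour_class g, of c] P'(2)
        by (metis disjoint_iff distinct_append)
    qed
    \<comment> \<open>The wall \<open>r\<close> has position \<open>length P + i\<close> in the address of \<open>g\<close>, and lies in its common part \<open>P'\<close> with that of \<open>b\<close>.\<close>
    then have "length P + i < length P'"
    proof -
      have "addr c g ! (length P + i) = r" by (subst P) (simp add: nth_append r_def)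
      moreover have "addr c g ! (length P + i) \<in> set ?R'" if "length P' \<le> length P + i"
      proof -
        have "length P + i < length (addr c g)" using i by (subst P) simp
        then have "length P + i - length P' < length ?R'" using that P'(2) by (metis add_diff_inverse_nat diff_less_mono length_append not_less add_diff_cancel_left')
        then show ?thesis using that by (subst P'(2)) (simp add: nth_append)
      qed
      ultimately show ?thesis using \<open>r \<notin> set ?R'\<close> by force
    qed
    then have "take (length P + (i + 1)) (P' @ ?R') = take (length P + (i + 1)) P'" by simp
    then have tk: "take (length P + (i + 1)) P' = P @ take (i + 1) ?Q"
      using P(1) P'(2) by (metis take_append take_all add_diff_cancel_left' le_add1)
    define Q1 where "Q1 = take (i + 1) ?Q @ drop (length P + (i + 1)) P' @ ?Q'"
    have "addr c b = P @ Q1"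
      using P'(1) tk append_take_drop_id[of "length P + (i + 1)" P'] unfolding Q1_def by (metis append_assoc)
    moreover have "Q1 = [] \<or> ?R = [] \<or> hd Q1 \<noteq> hd ?R"
    proof -
      have "hd Q1 = hd ?Q" "?Q \<noteq> []" using i unfolding Q1_def by (cases ?Q; auto)+
      moreover have "hd ?Q \<noteq> hd ?R" if "?R \<noteq> []"
        using distinct_branches[OF colour_class g h, of c] that \<open>?Q \<noteq> []\<close> by (cases ?Q; cases ?R; auto)
      ultimately show ?thesis by auto
    qed
    ultimately have "gromov_prod b h \<le> real (word_length b) - real (length Q1)"
      using gromov_prod_missing_walls[OF b h c _ P(2)] by blast
    moreover have "i + 1 \<le> length Q1" using i by (simp add: Q1_def)
    ultimately show ?thesis by linarith
  qed
  have "gromov_prod b h \<ge> min (gromov_prod b g) (gromov_prod g h) - \<delta>"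
    using hyp b h g by (simp add: word_hyperbolic_def)
  then have "gromov_prod g h \<le> word_length b" using bg bh_le i by (auto simp: min_def split: if_splits)
  then show "real (word_dist b g) \<le> real (word_dist g h) + 1 + 2 * \<delta>"
    using bg word_length_triangle[OF h g] word_dist_commute[OF g h] by (simp add: gromov_prod_def field_simps)
qed

text \<open>
  The coincidences to be excluded: \<open>N\<close> consecutive walls on either side of a branching, apart from the
  first \<open>K\<close> ones, where \<open>N\<close> is proportional to the distance.
\<close>

definition bad_pairs :: "nat \<Rightarrow> nat \<Rightarrow> nat \<Rightarrow> ('a list \<times> 'a list) set" where
  "bad_pairs c K L = {(take N (drop K (branch (addr c g) (addr c h))), take N (drop K (branch (addr c h) (addr c g)))) | g h N.
     g \<in> carrier G \<and> h \<in> carrier G \<and> 1 \<le> N \<and> word_dist g h \<le> L * N \<and>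
     K + N \<le> length (branch (addr c g) (addr c h)) \<and> K + N \<le> length (branch (addr c h) (addr c g))}"

text \<open>
  A pair of size \<open>N\<close> through \<open>r\<close> is determined by \<open>g\<close> and \<open>h\<close>. These lie in balls of radius \<open>(L + K) * N\<close>
  around the midpoint of \<open>r\<close> and of radius \<open>L * N\<close> around \<open>g\<close>, which have exponentially many elements
  at most.
\<close>

lemma sparse_bad_pairs:
  assumes hyp: "word_hyperbolic \<delta>" and c: "c < n" and K: "1 + 2 * \<delta> \<le> real K"
  shows "sparse_pairs (bad_pairs c K L) ((card S + 1) ^ (2 * L + K))"
proof
  let ?E = "bad_pairs c K L" and ?s = "card S + 1"
  have *: "\<exists>g\<in>carrier G. \<exists>h\<in>carrier G. \<exists>N\<ge>1. word_dist g h \<le> L * N \<and>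
     K + N \<le> length (branch (addr c g) (addr c h)) \<and> K + N \<le> length (branch (addr c h) (addr c g)) \<and>
     U = take N (drop K (branch (addr c g) (addr c h))) \<and> V = take N (drop K (branch (addr c h) (addr c g)))"
    if "(U, V) \<in> ?E" for U V
    using that unfolding bad_pairs_def by blast
  show "1 \<le> ?s ^ (2 * L + K)" by simp
  {
    fix U V assume "(U, V) \<in> ?E"
    then obtain g h N where UV: "g \<in> carrier G" "h \<in> carrier G" "1 \<le> N" "word_dist g h \<le> L * N"
       "K + N \<le> length (branch (addr c g) (addr c h))" "K + N \<le> length (branch (addr c h) (addr c g))"
       "U = take N (drop K (branch (addr c g) (addr c h)))" "V = take N (drop K (branch (addr c h) (addr c g)))"
      using * by meson
    show "(V, U) \<in> ?E"
      unfolding bad_pairs_def using UV word_dist_commute[OF UV(1,2)] by (intro CollectI exI[of _ h] exI[of _ g] exI[of _ N]) simp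
    show "length U = length V" using UV by simp
    have d: "distinct (branch (addr c g) (addr c h) @ branch (addr c h) (addr c g))"
      using distinct_branches[OF colour_class UV(1,2)] .
    then show "distinct U" using UV(7) by simp
    have "set U \<subseteq> set (branch (addr c g) (addr c h))" "set V \<subseteq> set (branch (addr c h) (addr c g))"
      unfolding UV(7,8) by (meson set_drop_subset set_take_subset subset_trans)+
    then show "set U \<inter> set V = {}" using d by auto
    show "U \<noteq> []" using UV by auto
  }
  have through: "finite {(U, V) \<in> ?E. r \<in> set U \<and> length U = N} \<and>
      card {(U, V) \<in> ?E. r \<in> set U \<and> length U = N} \<le> (?s ^ (2 * L + K)) ^ N" for r N
  proof -
    let ?T = "{(U, V) \<in> ?E. r \<in> set U \<and> length U = N}"
    let ?f = "\<lambda>(g, h). (take N (drop K (branch (addr c g) (addr c h))), take N (drop K (branch (addr c h) (addr c g))))"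
    let ?b = "midpoint c r"
    let ?X = "SIGMA g:{g \<in> carrier G. word_dist ?b g \<le> (L + K) * N}. {h \<in> carrier G. word_dist g h \<le> L * N}"
    have sub: "?T \<subseteq> ?f ` ?X \<and> ?b \<in> carrier G" if "?T \<noteq> {}"
    proof -
      have "p \<in> ?f ` ?X \<and> ?b \<in> carrier G" if pT: "p \<in> ?T" for p
      proof -
        obtain U V where p: "p = (U, V)" "(U, V) \<in> ?E" "r \<in> set U" "length U = N" using pT by blast
        obtain g h N' where UV: "g \<in> carrier G" "h \<in> carrier G" "1 \<le> N'" "word_dist g h \<le> L * N'"
           "K + N' \<le> length (branch (addr c g) (addr c h))" "K + N' \<le> length (branch (addr c h) (addr c g))"
           "U = take N' (drop K (branch (addr c g) (addr c h)))" "V = take N' (drop K (branch (addr c h) (addr c g)))"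
          using *[OF p(2)] by meson
        have N: "N' = N" using UV p(4) by simp
        obtain j where "j < length U" "U ! j = r" using p(3) by (auto simp: in_set_conv_nth)
        then have j: "branch (addr c g) (addr c h) ! (K + j) = r" "K + j < length (branch (addr c g) (addr c h))"
          using UV by auto
        have "2 * \<delta> < real (K + j)" using K by simp
        from midpoint_near[OF hyp UV(1,2) c j(2) this] have b: "?b \<in> carrier G"
          "real (word_dist ?b g) \<le> real (word_dist g h) + 1 + 2 * \<delta>" unfolding j(1) by auto
        have "real (word_dist ?b g) \<le> real (L * N + K)" using b(2) K UV(4) unfolding N by (simp flip: of_nat_mult)
        then have "word_dist ?b g \<le> L * N + K" by (simp only: of_nat_le_iff)
        also have "\<dots> \<le> (L + K) * N" using UV(3) unfolding N by (simp add: algebra_simps)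
        finally have "(g, h) \<in> ?X" using UV N by simp
        moreover have "p = ?f (g, h)" using p UV N by simp
        ultimately show ?thesis using b(1) by blast
      qed
      then show ?thesis using that by blast
    qed
    show ?thesis
    proof (cases "?T = {}")
      case True
      show ?thesis unfolding True by simp
    next
      case False
      then have b: "?b \<in> carrier G" and T: "?T \<subseteq> ?f ` ?X" using sub by auto
      have finX: "finite ?X" using ball_card(1) b by (intro finite_SigmaI) auto
      have "card ?X = (\<Sum>g\<in>{g \<in> carrier G. word_dist ?b g \<le> (L + K) * N}. card {h \<in> carrier G. word_dist g h \<le> L * N})"
        using ball_card(1) b by (intro card_SigmaI) auto
      also have "\<dots> \<le> card {g \<in> carrier G. word_dist ?b g \<le> (L + K) * N} * ?s ^ (L * N)"
        using sum_bounded_above[of "{g \<in> carrier G. word_dist ?b g \<le> (L + K) * N}" "\<lambda>g. card {h \<in> carrier G. word_dist g h \<le> L * N}" "?s ^ (L * N)"] ball_card(2)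
        by auto
      also have "\<dots> \<le> ?s ^ ((L + K) * N) * ?s ^ (L * N)"
        by (rule mult_le_mono1[OF ball_card(2)[OF b]])
      also have "\<dots> = (?s ^ (2 * L + K)) ^ N"
        by (simp only: power_add[symmetric] power_mult[symmetric] distrib_right mult_2 add_ac)
      finally have "card ?X \<le> (?s ^ (2 * L + K)) ^ N" .
      moreover have "card ?T \<le> card ?X" by (rule surj_card_le[OF finX T])
      ultimately show ?thesis using finite_subset[OF T] finX by auto
    qed
  qed
  show "finite {(U, V) \<in> ?E. r \<in> set U \<and> length U = N}" for r N using through by blast
  show "card {(U, V) \<in> ?E. r \<in> set U \<and> length U = N} \<le> (?s ^ (2 * L + K)) ^ N" for r N using through by blast
qed

text \<open>
  Suppose that \<open>g\<close> and \<open>h\<close> violate the bound. In some colour \<open>c\<close>, the addresses have distance at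
  least \<open>d(g, h) / n\<close>, while the labels beyond the branching agree along a common prefix \<open>Z\<close>. As the
  distance of the labelled addresses is small, \<open>Z\<close> has length at least \<open>d(g, h) / (4 n)\<close>, and it is so
  long that at least half of it is left when its first \<open>K\<close> entries are dropped. What is left has size
  \<open>N\<close> with \<open>d(g, h) \<le> 8 n N\<close>, and is a coincidence that the labelling excludes.
\<close>

theorem exists_labelling:
  assumes hyp: "word_hyperbolic \<delta>"
  shows "\<exists>(M::nat) A lab. 1 \<le> M \<and> (\<forall>c r. lab c r < M) \<and> (\<forall>g\<in>carrier G. \<forall>h\<in>carrier G.
     word_dist g h \<le> 2 * n * (\<Sum>c<n. tree_dist (map (lab c) (addr c g)) (map (lab c) (addr c h))) + A)"
proof -
  define K where "K = nat \<lceil>1 + 2 * \<delta>\<rceil>"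
  have K: "1 + 2 * \<delta> \<le> real K" unfolding K_def by linarith
  let ?M = "4 * (card S + 1) ^ (2 * (8 * n) + K)"
  have "\<forall>c. \<exists>l. (\<forall>r. l r < ?M) \<and> (c < n \<longrightarrow> (\<forall>(U, V)\<in>bad_pairs c K (8 * n). map l U \<noteq> map l V))"
  proof
    fix c
    show "\<exists>l. (\<forall>r. l r < ?M) \<and> (c < n \<longrightarrow> (\<forall>(U, V)\<in>bad_pairs c K (8 * n). map l U \<noteq> map l V))"
    proof (cases "c < n")
      case True
      then show ?thesis
        using sparse_pairs.exists_separating_labelling[OF sparse_bad_pairs[OF hyp True K, of "8 * n"]] by blast
    qed (auto intro: exI[of _ "\<lambda>_. 0"])
  qed
  from choice[OF this] obtain lab where *: "\<And>c. (\<forall>r. lab c r < ?M) \<and>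
      (c < n \<longrightarrow> (\<forall>(U, V)\<in>bad_pairs c K (8 * n). map (lab c) U \<noteq> map (lab c) V))" by blast
  then have lab: "\<And>c r. lab c r < ?M"
    and sep: "\<And>c U V. c < n \<Longrightarrow> (U, V) \<in> bad_pairs c K (8 * n) \<Longrightarrow> map (lab c) U \<noteq> map (lab c) V"
    by blast+
  have main: "word_dist g h \<le> 2 * n * (\<Sum>c<n. tree_dist (map (lab c) (addr c g)) (map (lab c) (addr c h))) + 8 * n * K"
    if g: "g \<in> carrier G" and h: "h \<in> carrier G" for g h
  proof (rule ccontr)
    let ?D = "\<lambda>c. tree_dist (map (lab c) (addr c g)) (map (lab c) (addr c h))"
    let ?t = "\<lambda>c. tree_dist (addr c g) (addr c h)"
    assume "\<not> word_dist g h \<le> 2 * n * (\<Sum>c<n. ?D c) + 8 * n * K"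
    then have big: "2 * n * (\<Sum>c<n. ?D c) + 8 * n * K < word_dist g h" by simp
    have "\<exists>c<n. word_dist g h \<le> n * ?t c"
    proof (rule ccontr)
      assume "\<not> (\<exists>c<n. word_dist g h \<le> n * ?t c)"
      then have "n * ?t c < word_dist g h" if "c < n" for c using that by (simp add: not_le)
      moreover have "n > 0" using big word_dist_eq_sum_tree_dist[OF g h] by (cases n) auto
      ultimately have "(\<Sum>c<n. n * ?t c) < (\<Sum>c<n. word_dist g h)"
        by (intro sum_strict_mono) auto
      then show False by (simp add: word_dist_eq_sum_tree_dist[OF g h] flip: sum_distrib_left)
    qed
    then obtain c where c: "c < n" "word_dist g h \<le> n * ?t c" by (elim exE conjE)
    let ?Q = "branch (addr c g) (addr c h)" and ?R = "branch (addr c h) (addr c g)"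
    let ?Q' = "branch (map (lab c) ?Q) (map (lab c) ?R)" and ?R' = "branch (map (lab c) ?R) (map (lab c) ?Q)"
    obtain P where P: "addr c g = P @ ?Q" "addr c h = P @ ?R" using branch_common_prefix by blast
    obtain Z where Z: "map (lab c) ?Q = Z @ ?Q'" "map (lab c) ?R = Z @ ?R'" using branch_common_prefix by blast
    have "?D c = tree_dist (map (lab c) ?Q) (map (lab c) ?R)"
      by (subst P(1), subst P(2)) (simp only: map_append tree_dist_append)
    then have D: "?D c = length ?Q' + length ?R'" by (simp add: tree_dist_def)
    have lens: "length ?Q = length Z + length ?Q'" "length ?R = length Z + length ?R'"
      using arg_cong[OF Z(1), of length] arg_cong[OF Z(2), of length] by simp_all
    then have t: "?t c = ?D c + 2 * length Z" unfolding D by (simp add: tree_dist_def)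
    have "?D c \<le> (\<Sum>c<n. ?D c)" using c(1) by (intro member_le_sum) auto
    then have "2 * n * ?D c \<le> 2 * n * (\<Sum>c<n. ?D c)" by (rule mult_le_mono2)
    then have "2 * n * ?D c + 8 * n * K < n * ?t c" using big c(2) by linarith
    then have "n * (2 * ?D c + 8 * K) < n * ?t c" by (simp add: distrib_left mult_ac)
    then have "2 * ?D c + 8 * K < ?t c" by simp
    then have Z_big: "?D c + 8 * K < 2 * length Z" unfolding t by simp
    define N where "N = length Z - K"
    have N: "K + N = length Z" "1 \<le> N" "?t c \<le> 8 * N" using Z_big unfolding N_def t by auto
    have "word_dist g h \<le> n * ?t c" by (fact c(2))
    also have "\<dots> \<le> 8 * n * N" using mult_le_mono2[OF N(3), of n] by (simp add: algebra_simps)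
    finally have "word_dist g h \<le> 8 * n * N" .
    then have "(take N (drop K ?Q), take N (drop K ?R)) \<in> bad_pairs c K (8 * n)"
      unfolding bad_pairs_def using N(1,2) g h lens
      by (intro CollectI exI[of _ g] exI[of _ h] exI[of _ N]) simp
    moreover have "map (lab c) (take N (drop K ?Q)) = map (lab c) (take N (drop K ?R))"
    proof -
      have "take N (drop K (Z @ W)) = drop K Z" for W :: "nat list" using N(1) by (simp add: take_drop)
      then show ?thesis unfolding take_map[symmetric] drop_map[symmetric] by (metis Z)
    qed
    ultimately show False using sep[OF c(1)] by blast
  qed
  show ?thesis
  proof (rule exI[of _ ?M], rule exI[of _ "8 * n * K"], rule exI[of _ lab], intro conjI allI ballI)
    show "1 \<le> ?M" by simp
  qed (fact lab main)+
qed

end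

section \<open>The Cayley graph\<close>

context racg
begin

lemma graph_walk_word:
  assumes "g \<in> carrier G" "set w \<subseteq> S"
  shows "graph_walk (cayley_edges G S) (length w) g (g \<otimes> value_of w)"
  using assms(2)
proof (induction w rule: rev_induct)
  case Nil
  show ?case using assms(1) by (simp add: graph_walk.stay)
next
  case (snoc s w)
  have "{g \<otimes> value_of w, g \<otimes> value_of (w @ [s])} \<in> cayley_edges G S"
    unfolding cayley_edges_def using snoc.prems assms(1)
    by (intro CollectI exI[of _ "g \<otimes> value_of w"] exI[of _ s]) (simp add: m_assoc)
  from graph_walk.step[OF _ this] snoc show ?case by simp
qed

text \<open>
  Left translations are isometries, so walks realizing the distance are the translates of reduced
  words.
\<close>

lemma path_metric_cayley_graph: "path_metric_graph (carrier G) (cayley_edges G S) word_dist"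
proof
  fix e assume "e \<in> cayley_edges G S"
  then obtain g s where gs: "e = {g, g \<otimes> s}" "g \<in> carrier G" "s \<in> S"
    by (auto simp: cayley_edges_def)
  then show "\<exists>u\<in>carrier G. \<exists>v\<in>carrier G. u \<noteq> v \<and> e = {u, v}"
    using S_not_one[of s] by (intro bexI[of _ g] bexI[of _ "g \<otimes> s"]) auto
next
  fix u assume "u \<in> carrier G" then show "word_dist u u = 0" by (simp add: word_dist_def)
next
  fix u v w assume u: "u \<in> carrier G" and e: "{v, w} \<in> cayley_edges G S"
  have le: "word_dist u (g \<otimes> s) \<le> word_dist u g + 1" if "g \<in> carrier G" "s \<in> S" for g s
  proof -
    have "word_length s \<le> 1" using word_length_le[of "[s]"] that by simp
    then show ?thesis using word_length_mult_le[of "inv u \<otimes> g" s] that u by (simp add: word_dist_def m_assoc)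
  qed
  obtain g s where gs: "{v, w} = {g, g \<otimes> s}" "g \<in> carrier G" "s \<in> S"
    using e by (auto simp: cayley_edges_def)
  have "g \<otimes> s \<otimes> s = g" using gs by (simp add: m_assoc)
  then have "word_dist u g \<le> word_dist u (g \<otimes> s) + 1" using le[of "g \<otimes> s" s] gs by simp
  then show "word_dist u w \<le> word_dist u v + 1" using gs le[of g s] by (auto simp: doubleton_eq_iff)
next
  fix u v assume uv: "u \<in> carrier G" "v \<in> carrier G"
  obtain w where w: "reduced w" "value_of w = inv u \<otimes> v"
    using exists_reduced[of "inv u \<otimes> v"] uv by auto
  then show "graph_walk (cayley_edges G S) (word_dist u v) u v"
    using graph_walk_word[OF uv(1), of w] uv by (simp add: word_dist_def reduced_def flip: m_assoc)
qed

sublocale cayley: path_metric_graph "carrier G" "cayley_edges G S" word_dist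
  by (rule path_metric_cayley_graph)

lemma cayley_dist_vertices:
  "g \<in> carrier G \<Longrightarrow> h \<in> carrier G \<Longrightarrow> cayley_dist G S (vertex_point g) (vertex_point h) = word_dist g h"
  unfolding cayley_dist_def by (rule cayley.graph_dist_vertices)

text \<open>
  A vertex of a cell that contains \<open>p\<close>; it has distance at most 1 from \<open>p\<close>.
\<close>

definition nearby_vertex :: "('a \<Rightarrow> real) \<Rightarrow> 'a" where
  "nearby_vertex p = (SOME g. \<exists>\<sigma>\<in>graph_cells (carrier G) (cayley_edges G S). p \<in> cell_points \<sigma> \<and> g \<in> \<sigma>)"

lemma nearby_vertex:
  assumes "p \<in> cayley_graph G S"
  shows "\<exists>\<sigma>\<in>graph_cells (carrier G) (cayley_edges G S). p \<in> cell_points \<sigma> \<and> nearby_vertex p \<in> \<sigma>"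
  unfolding nearby_vertex_def
proof (rule someI_ex)
  obtain \<sigma> where \<sigma>: "\<sigma> \<in> graph_cells (carrier G) (cayley_edges G S)" "p \<in> cell_points \<sigma>"
    using assms by (auto simp: cayley_graph_def graph_points_def)
  then have "\<sigma> \<noteq> {}" by (auto simp: cell_points_def)
  then show "\<exists>g. \<exists>\<sigma>\<in>graph_cells (carrier G) (cayley_edges G S). p \<in> cell_points \<sigma> \<and> g \<in> \<sigma>"
    using \<sigma> by blast
qed

lemma nearby_vertex_carrier: "p \<in> cayley_graph G S \<Longrightarrow> nearby_vertex p \<in> carrier G"
  using nearby_vertex cayley.cell_subset by blast

lemma cayley_dist_near:
  assumes "p \<in> cayley_graph G S" "q \<in> cayley_graph G S"
  shows "\<bar>cayley_dist G S p q - word_dist (nearby_vertex p) (nearby_vertex q)\<bar> \<le> 2"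
  using nearby_vertex[OF assms(1)] nearby_vertex[OF assms(2)] cayley.graph_dist_near_vertices
  unfolding cayley_dist_def by blast

end

lemma (in coloured_racg) word_hyperbolic_cayley:
  assumes "gromov_hyperbolic (cayley_graph G S) (cayley_dist G S)"
  shows "\<exists>\<delta>. word_hyperbolic \<delta>"
proof -
  obtain \<delta> where \<delta>: "\<And>w x y z. w \<in> cayley_graph G S \<Longrightarrow> x \<in> cayley_graph G S \<Longrightarrow> y \<in> cayley_graph G S \<Longrightarrow>
      z \<in> cayley_graph G S \<Longrightarrow> gromov_product (cayley_dist G S) w x z \<ge>
        min (gromov_product (cayley_dist G S) w x y) (gromov_product (cayley_dist G S) w y z) - \<delta>"
    using assms unfolding gromov_hyperbolic_def by blast
  have v: "vertex_point g \<in> cayley_graph G S" if "g \<in> carrier G" for g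
    using cayley.vertex_point_in_graph[OF that] by (simp add: cayley_graph_def)
  have p: "gromov_product (cayley_dist G S) (vertex_point \<one>) (vertex_point g) (vertex_point h) = gromov_prod g h"
    if "g \<in> carrier G" "h \<in> carrier G" for g h
    using that by (simp add: gromov_product_def gromov_prod_def cayley_dist_vertices word_dist_commute[of _ \<one>])
  have "word_hyperbolic \<delta>"
    unfolding word_hyperbolic_def using \<delta>[OF v v v v] by (simp flip: p)
  then show ?thesis ..
qed

context coloured_racg
begin

text \<open>
  A point of the Cayley graph is sent to the encoded labelled addresses of a nearby vertex, one for
  each colour. Replacing walls by labels does not increase distances, and encoding multiplies them by
  at most \<open>M\<close>; this gives the upper bound.
\<close>

theorem quasiisometric_embedding_exists:
  assumes "gromov_hyperbolic (cayley_graph G S) (cayley_dist G S)"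
  shows "\<exists>\<psi>. quasiisometric_embedding (cayley_graph G S) (cayley_dist G S)
    (power_space n binary_tree) (l1_dist n binary_tree_dist) \<psi>"
proof -
  obtain \<delta> where "word_hyperbolic \<delta>" using word_hyperbolic_cayley[OF assms] by blast
  from exists_labelling[OF this] obtain M :: nat and A lab where M: "1 \<le> M" and lab: "\<And>c r. lab c r < M"
    and lower: "\<And>g h. g \<in> carrier G \<Longrightarrow> h \<in> carrier G \<Longrightarrow>
      word_dist g h \<le> 2 * n * (\<Sum>c<n. tree_dist (map (lab c) (addr c g)) (map (lab c) (addr c h))) + A"
    by blast
  define code where "code c g = encode M (map (lab c) (addr c g))" for c g
  have lt: "set (map (lab c) xs) \<subseteq> {..<M}" for c xs using lab by auto
  have code_le: "(\<Sum>c<n. tree_dist (code c g) (code c h)) \<le> M * word_dist g h"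
    if "g \<in> carrier G" "h \<in> carrier G" for g h
  proof -
    have "tree_dist (code c g) (code c h) \<le> M * tree_dist (addr c g) (addr c h)" for c
      unfolding code_def
      by (rule le_trans[OF tree_dist_encode_le[OF lt lt] mult_le_mono2[OF tree_dist_map_le]])
    then show ?thesis
      unfolding word_dist_eq_sum_tree_dist[OF that] sum_distrib_left by (intro sum_mono)
  qed
  have code_ge: "word_dist g h \<le> 2 * n * (\<Sum>c<n. tree_dist (code c g) (code c h)) + (4 * n * n + A)"
    if "g \<in> carrier G" "h \<in> carrier G" for g h
  proof -
    have "tree_dist (map (lab c) (addr c g)) (map (lab c) (addr c h)) \<le> tree_dist (code c g) (code c h) + 2" for c
    proof -
      let ?t = "tree_dist (map (lab c) (addr c g)) (map (lab c) (addr c h))"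
      have "M * ?t \<le> tree_dist (code c g) (code c h) + 2 * M"
        unfolding code_def by (rule tree_dist_encode_ge[OF lt lt])
      also have "\<dots> \<le> M * (tree_dist (code c g) (code c h) + 2)" using M by (simp add: algebra_simps)
      finally show ?thesis unfolding mult_le_cancel1 using M by simp
    qed
    then have "(\<Sum>c<n. tree_dist (map (lab c) (addr c g)) (map (lab c) (addr c h)))
        \<le> (\<Sum>c<n. tree_dist (code c g) (code c h) + 2)" by (intro sum_mono)
    also have "\<dots> = (\<Sum>c<n. tree_dist (code c g) (code c h)) + 2 * n" by (subst sum.distrib) simp
    finally have "2 * n * (\<Sum>c<n. tree_dist (map (lab c) (addr c g)) (map (lab c) (addr c h)))
        \<le> 2 * n * ((\<Sum>c<n. tree_dist (code c g) (code c h)) + 2 * n)" by (rule mult_le_mono2)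
    then show ?thesis using lower[OF that] by (simp add: algebra_simps)
  qed
  define \<psi> where "\<psi> p = (\<lambda>c\<in>{..<n}. vertex_point (code c (nearby_vertex p)))" for p
  have target: "l1_dist n binary_tree_dist (\<psi> p) (\<psi> q)
      = (\<Sum>c<n. tree_dist (code c (nearby_vertex p)) (code c (nearby_vertex q)))" for p q
    by (simp add: l1_dist_def \<psi>_def binary_tree_dist_def binary_tree.graph_dist_vertices)
  let ?L = "real (2 * n + M)" and ?A = "real (4 * n * n + A + 2 + 2 * M + 4 * n)"
  have "quasiisometric_embedding (cayley_graph G S) (cayley_dist G S)
    (power_space n binary_tree) (l1_dist n binary_tree_dist) \<psi>"
    unfolding quasiisometric_embedding_def
  proof (rule conjI, goal_cases)
    case 1
    show "\<psi> \<in> cayley_graph G S \<rightarrow> power_space n binary_tree"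
      using binary_tree.vertex_point_in_graph by (auto simp: \<psi>_def power_space_def binary_tree_def)
  next
    case 2
    show ?case
    proof (rule exI[of _ ?L], rule exI[of _ ?A], intro conjI ballI)
      show "1 \<le> ?L" using M by simp
      show "0 \<le> ?A" by simp
      fix p q assume pq: "p \<in> cayley_graph G S" "q \<in> cayley_graph G S"
      let ?g = "nearby_vertex p" and ?h = "nearby_vertex q"
      let ?e = "\<Sum>c<n. tree_dist (code c ?g) (code c ?h)"
      note gh = nearby_vertex_carrier[OF pq(1)] nearby_vertex_carrier[OF pq(2)]
      have near: "\<bar>cayley_dist G S p q - word_dist ?g ?h\<bar> \<le> 2" by (rule cayley_dist_near[OF pq])
      have "word_dist ?g ?h \<le> 2 * n * ?e + (4 * n * n + A)" by (rule code_ge[OF gh])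
      also have "\<dots> \<le> (2 * n + M) * ?e + (4 * n * n + A)" by simp
      finally have "real (word_dist ?g ?h) \<le> real ((2 * n + M) * ?e + (4 * n * n + A))"
        by (simp only: of_nat_le_iff)
      then have "cayley_dist G S p q \<le> ?L * real ?e + (real (4 * n * n + A) + 2)"
        using near by (simp only: of_nat_add of_nat_mult)
      also have "\<dots> \<le> ?L * real ?e + ?L * ?A"
      proof -
        have "real (4 * n * n + A) + 2 \<le> 1 * ?A" by simp
        also have "\<dots> \<le> ?L * ?A" using M by (intro mult_right_mono) auto
        finally show ?thesis by simp
      qed
      also have "\<dots> = ?L * (real ?e + ?A)" by (simp only: distrib_left)
      finally have "cayley_dist G S p q / ?L \<le> real ?e + ?A"
        using M by (subst pos_divide_le_eq) (auto simp: mult.commute)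
      then show "cayley_dist G S p q / ?L - ?A \<le> l1_dist n binary_tree_dist (\<psi> p) (\<psi> q)"
        by (simp only: target diff_le_eq)
      have "real ?e \<le> real (M * word_dist ?g ?h)" using code_le[OF gh] by (simp only: of_nat_le_iff)
      also have "\<dots> \<le> ?L * real (word_dist ?g ?h)" by (simp add: mult_right_mono)
      also have "\<dots> \<le> ?L * (cayley_dist G S p q + 2)" using near by (intro mult_left_mono) auto
      also have "\<dots> \<le> ?L * cayley_dist G S p q + ?A" by (simp add: distrib_left)
      finally show "l1_dist n binary_tree_dist (\<psi> p) (\<psi> q) \<le> ?L * cayley_dist G S p q + ?A"
        by (simp only: target)
    qed
  qed
  then show ?thesis by (intro exI[of _ \<psi>])
qed

end

text \<open>
  An injective colouring shows that the minimum defining the chromatic number is attained.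
\<close>

lemma exists_optimal_colouring:
  assumes "finite S"
  shows "\<exists>c. proper_colouring S E (chromatic_number S E) c"
proof -
  obtain c where "bij_betw c S {..<card S}"
    using ex_bij_betw_finite_nat[OF assms] by (auto simp: lessThan_atLeast0)
  then have "inj_on c S" "c ` S \<subseteq> {..<card S}" by (auto simp: bij_betw_def)
  then have "proper_colouring S E (card S) c" unfolding proper_colouring_def inj_on_def by blast
  then have "\<exists>k c. proper_colouring S E k c" by blast
  then show ?thesis unfolding chromatic_number_def by (rule LeastI_ex)
qed

theorem theorem1p1:
  fixes G :: "('a, 'b) monoid_scheme" and S :: "'a set" and n :: nat
  assumes "right_angled_coxeter_group G S"
    and "gromov_hyperbolic (cayley_graph G S) (cayley_dist G S)"
    and "racg_chromatic_number G S = n"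
  shows "\<exists>\<psi>. quasiisometric_embedding
               (cayley_graph G S) (cayley_dist G S)
               (power_space n binary_tree) (l1_dist n binary_tree_dist) \<psi>"
proof -
  from assms(1) obtain C where grp: "group G" and fin: "finite S" and sub: "S \<subseteq> carrier G"
    and gen: "generate G S = carrier G" and ord: "\<forall>s\<in>S. group.ord G s = 2"
    and C: "C \<subseteq> S \<times> S" "\<forall>(s, t)\<in>C. s \<otimes>\<^bsub>G\<^esub> t = t \<otimes>\<^bsub>G\<^esub> s"
    and pres: "\<forall>w\<in>lists (S \<times> UNIV). word_value G w = \<one>\<^bsub>G\<^esub> \<longrightarrow> racg_equiv S C w []"
    unfolding right_angled_coxeter_group_def by blast
  obtain col where col: "proper_colouring S (edges_of_complex (nerve G S)) n col"
    using exists_optimal_colouring[OF fin] assms(3) unfolding racg_chromatic_number_def by blast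
  interpret group G by (rule grp)
  interpret coloured_racg G S C col n
  proof
    show "finite S" "S \<subseteq> carrier G" "generate G S = carrier G" "C \<subseteq> S \<times> S" by fact+
    show "ord s = 2" if "s \<in> S" for s using ord that by (rule bspec)
    show "s \<otimes>\<^bsub>G\<^esub> t = t \<otimes>\<^bsub>G\<^esub> s" if "(s, t) \<in> C" for s t using bspec[OF C(2) that] by simp
    show "racg_equiv S C w []" if "w \<in> lists (S \<times> UNIV)" "word_value G w = \<one>\<^bsub>G\<^esub>" for w
      using bspec[OF pres that(1)] that(2) by (rule mp)
    show "col s < n" if "s \<in> S" for s using col that by (auto simp: proper_colouring_def)
    fix s t assume st: "s \<in> S" "t \<in> S" "s \<otimes>\<^bsub>G\<^esub> t = t \<otimes>\<^bsub>G\<^esub> s" "s \<noteq> t"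
    then have "{s, t} \<in> edges_of_complex (nerve G S)"
      by (auto simp: edges_of_complex_def nerve_def)
    then show "col s \<noteq> col t" using col st unfolding proper_colouring_def by blast
  qed
  show ?thesis by (rule quasiisometric_embedding_exists[OF assms(2)])
qed

end
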